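(* Let $-1<q<1$. (i) Let $a,b,c,d$ be complex numbers of modulus less than $1$ that are real or, if complex, occur in conjugate pairs. Then for every $n\ge 1$, $$D_n(x|a,b,c,d,q)=\frac{(ab)_n(cd)_n}{(abcdq^{n-1})_n}\sum_{j=0}^{n}\begin{bmatrix} n \\ j \end{bmatrix}_q b_{n-j}(x|q)\sum_{i=0}^{j}\begin{bmatrix} j \\ i \end{bmatrix}_q\frac{Q_i(x|a,b,q)\,Q_{j-i}(x|c,d,q)}{(ab)_i\,(cd)_{j-i}} .$$ Let furthermore $|\rho_1|,|\rho_2|<1$ be real and let $y,z\in[-2/\sqrt{1-q},\,2/\sqrt{1-q}]$. (ii) For every $n\ge 1$, $$A_n(x|y,\rho_1,z,\rho_2,q)=\frac{(\rho_1^2)_n(\rho_2^2)_n}{(\rho_1^2\rho_2^2q^{n-1})_n}\sum_{j=0}^{n}\begin{bmatrix} n \\ j \end{bmatrix}_q B_{n-j}(x|q)\sum_{i=0}^{j}\begin{bmatrix} j \\ i \end{bmatrix}_q\frac{P_i(x|y,\rho_1,q)\,P_{j-i}(x|z,\rho_2,q)}{(\rho_1^2)_i\,(\rho_2^2)_{j-i}} .$$ (iii) For every $n\ge 1$, $$A_n(x|y,\rho_1,z,\rho_2,q)=\frac{(\rho_1^2)_n(\rho_2^2)_n}{(\rho_1^2\rho_2^2q^{n-1})_n}\sum_{m=0}^{n}(-1)^m q^{\binom m2}\begin{bmatrix} n \\ m \end{bmatrix}_q\rho_1^m\,\frac{P_{n-m}(x|z,\rho_2,q)\,P_m(y|x,\rho_1,q)}{(\rho_2^2)_{n-m}\,(\rho_1^2)_m}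 .$$
   Context: Notation: $(\alpha)_n=(\alpha;q)_n=\prod_{i=0}^{n-1}(1-\alpha q^i)$, $(\alpha)_0=1$, $(\alpha)_\infty=\prod_{i\ge0}(1-\alpha q^i)$, with $0^0=1$; $[n]_q=1+q+\dots+q^{n-1}$, $[0]_q=0$, $[n]_q!=\prod_{i=1}^n[i]_q$, $[0]_q!=1$; $\begin{bmatrix} n \\ k \end{bmatrix}_q=\frac{[n]_q!}{[k]_q![n-k]_q!}$ for $0\le k\le n$ and $0$ otherwise. Askey--Wilson polynomials: $D_n(x|a,b,c,d,q)$ is the polynomial in $x$ of degree $n$ with leading coefficient $2^n$ such that $\{D_n\}_{n\ge0}$ is orthogonal on $[-1,1]$ with respect to the Askey--Wilson weight $$\frac{1}{\sqrt{1-x^2}}\,\frac{(e^{2i\theta})_\infty(e^{-2i\theta})_\infty}{\prod_{h\in\{a,b,c,d\}}(he^{i\theta})_\infty(he^{-i\theta})_\infty},\qquad x=\cos\theta$$ (the product over $h$ counted with multiplicity). Equivalently, when $q\ne0$ and $a\neq 0$, $$D_n(\cos\theta|a,b,c,d,q)=\frac{(ab)_n(ac)_n(ad)_n}{a^n(abcdq^{n-1})_n}\sum_{k=0}^{n}\frac{(q^{-n})_k(abcdq^{n-1})_k(ae^{i\theta})_k(ae^{-i\theta})_k}{(ab)_k(ac)_k(ad)_k(q)_k}\,q^k$$ whenever the denominators do not vanish. Al-Salam--Chihara polynomials $Q_n$: $Q_{-1}=0$, $Q_0=1$, $Q_{n+1}(x|a,b,q)=(2x-(a+b)q^n)Q_n(x|a,b,q)-(1-abq^{n-1})(1-q^n)Q_{n-1}(x|a,b,q)$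 for $n\ge0$. Polynomials $P_n$: $P_{-1}=0$, $P_0=1$, $P_{n+1}(x|y,\rho,q)=(x-\rho yq^n)P_n(x|y,\rho,q)-(1-\rho^2q^{n-1})[n]_qP_{n-1}(x|y,\rho,q)$ for $n\ge0$. In these recurrences the terms multiplied by $P_{-1}$, $Q_{-1}$ vanish. $P_m(y|x,\rho,q)$ denotes the same polynomial with the roles of $x$ and $y$ exchanged. Polynomials $b_n$: $b_{-1}=0$, $b_0=1$, $b_{n+1}(x|q)=-2q^nx\,b_n(x|q)+q^{n-1}(1-q^n)b_{n-1}(x|q)$ for $n\ge0$. Polynomials $B_n$: $B_{-1}=0$, $B_0=1$, $B_{n+1}(x|q)=-q^nx\,B_n(x|q)+q^{n-1}[n]_qB_{n-1}(x|q)$ for $n\ge0$ (terms with index $-1$ vanish). Rescaled Askey--Wilson polynomials: $$A_n(x|y,\rho_1,z,\rho_2,q)=(1-q)^{-n/2}D_n\Big(\tfrac{x\sqrt{1-q}}{2}\,\Big|\,a,b,c,d,q\Big),$$ where, with $\mathrm i$ the imaginary unit, $a,b=\frac{\sqrt{1-q}}2\rho_1\big(y\mp \mathrm i\sqrt{\tfrac4{1-q}-y^2}\big)$ and $c,d=\frac{\sqrt{1-q}}2\rho_2\big(z\mp \mathrm i\sqrt{\tfrac4{1-q}-z^2}\big)$ (so $A_n$ is monic in $x$). *)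

theory Defs
  imports
    "HOL-Analysis.Analysis"
    "HOL-Computational_Algebra.Polynomial"
    "HOL-Library.Multiset"
begin

definition qpoch :: "complex \<Rightarrow> complex \<Rightarrow> nat \<Rightarrow> complex" where
  "qpoch \<alpha> q n = (\<Prod>i<n. 1 - \<alpha> * q ^ i)"

definition qpoch_inf :: "complex \<Rightarrow> complex \<Rightarrow> complex" where
  "qpoch_inf \<alpha> q = (\<Prod>i. 1 - \<alpha> * q ^ i)"

definition qnum :: "complex \<Rightarrow> nat \<Rightarrow> complex" where
  "qnum q n = (\<Sum>i<n. q ^ i)"

definition qfact :: "complex \<Rightarrow> nat \<Rightarrow> complex" where
  "qfact q n = (\<Prod>i=1..n. qnum q i)"

definition qbinom :: "complex \<Rightarrow> nat \<Rightarrow> nat \<Rightarrow> complex" where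
  "qbinom q n k = (if k \<le> n then qfact q n / (qfact q k * qfact q (n - k)) else 0)"

(* The angle is theta = arccos x, for -1 <= x <= 1. *)
definition aw_weight :: "complex \<Rightarrow> complex \<Rightarrow> complex \<Rightarrow> complex \<Rightarrow> complex \<Rightarrow> real \<Rightarrow> complex" where
  "aw_weight a b c d q x =
     (let \<theta> = arccos x; h = (\<lambda>s. qpoch_inf (s * cis \<theta>) q * qpoch_inf (s * cis (- \<theta>)) q)
      in 1 / complex_of_real (sqrt (1 - x\<^sup>2))
         * (qpoch_inf (cis (2 * \<theta>)) q * qpoch_inf (cis (- (2 * \<theta>))) q)
         / (h a * h b * h c * h d))"

(* The polynomials have complex coefficients, and orthogonality refers to the bilinear form
   (f, g) \<mapsto> integral of f g w, without conjugation; existence of the integral is part of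
   the condition. *)
definition is_aw_system ::
  "complex \<Rightarrow> complex \<Rightarrow> complex \<Rightarrow> complex \<Rightarrow> complex \<Rightarrow> (nat \<Rightarrow> complex poly) \<Rightarrow> bool" where
  "is_aw_system a b c d q D \<longleftrightarrow>
     (\<forall>n. degree (D n) = n \<and> lead_coeff (D n) = 2 ^ n) \<and>
     (\<forall>m n. m \<noteq> n \<longrightarrow>
        ((\<lambda>x::real. poly (D m) (complex_of_real x) * poly (D n) (complex_of_real x)
            * aw_weight a b c d q x) has_integral 0) {-1..1})"

definition aw_poly ::
  "nat \<Rightarrow> complex \<Rightarrow> complex \<Rightarrow> complex \<Rightarrow> complex \<Rightarrow> complex \<Rightarrow> complex poly" where
  "aw_poly n a b c d q = (THE D. is_aw_system a b c d q D) n"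

(* In the recurrences below the case Suc 0 has the term with index -1 dropped. *)

fun asc_Q :: "nat \<Rightarrow> complex \<Rightarrow> complex \<Rightarrow> complex \<Rightarrow> complex \<Rightarrow> complex" where
  "asc_Q 0 x a b q = 1"
| "asc_Q (Suc 0) x a b q = 2 * x - (a + b)"
| "asc_Q (Suc (Suc n)) x a b q =
     (2 * x - (a + b) * q ^ Suc n) * asc_Q (Suc n) x a b q
     - (1 - a * b * q ^ n) * (1 - q ^ Suc n) * asc_Q n x a b q"

fun asc_P :: "nat \<Rightarrow> complex \<Rightarrow> complex \<Rightarrow> complex \<Rightarrow> complex \<Rightarrow> complex" where
  "asc_P 0 x y \<rho> q = 1"
| "asc_P (Suc 0) x y \<rho> q = x - \<rho> * y"
| "asc_P (Suc (Suc n)) x y \<rho> q =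
     (x - \<rho> * y * q ^ Suc n) * asc_P (Suc n) x y \<rho> q
     - (1 - \<rho>\<^sup>2 * q ^ n) * qnum q (Suc n) * asc_P n x y \<rho> q"

fun small_b :: "nat \<Rightarrow> complex \<Rightarrow> complex \<Rightarrow> complex" where
  "small_b 0 x q = 1"
| "small_b (Suc 0) x q = - 2 * x"
| "small_b (Suc (Suc n)) x q =
     - 2 * q ^ Suc n * x * small_b (Suc n) x q + q ^ n * (1 - q ^ Suc n) * small_b n x q"

fun big_B :: "nat \<Rightarrow> complex \<Rightarrow> complex \<Rightarrow> complex" where
  "big_B 0 x q = 1"
| "big_B (Suc 0) x q = - x"
| "big_B (Suc (Suc n)) x q =
     - (q ^ Suc n) * x * big_B (Suc n) x q + q ^ n * qnum q (Suc n) * big_B n x q"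

definition aw_par_minus :: "real \<Rightarrow> real \<Rightarrow> real \<Rightarrow> complex" where
  "aw_par_minus \<rho> y q = complex_of_real (sqrt (1 - q) / 2 * \<rho>)
     * (complex_of_real y - \<i> * complex_of_real (sqrt (4 / (1 - q) - y\<^sup>2)))"

definition aw_par_plus :: "real \<Rightarrow> real \<Rightarrow> real \<Rightarrow> complex" where
  "aw_par_plus \<rho> y q = complex_of_real (sqrt (1 - q) / 2 * \<rho>)
     * (complex_of_real y + \<i> * complex_of_real (sqrt (4 / (1 - q) - y\<^sup>2)))"

definition aw_A :: "nat \<Rightarrow> complex \<Rightarrow> real \<Rightarrow> real \<Rightarrow> real \<Rightarrow> real \<Rightarrow> real \<Rightarrow> complex" where
  "aw_A n x y \<rho>\<^sub>1 z \<rho>\<^sub>2 q =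
     complex_of_real ((1 - q) powr (- real n / 2))
     * poly (aw_poly n (aw_par_minus \<rho>\<^sub>1 y q) (aw_par_plus \<rho>\<^sub>1 y q)
               (aw_par_minus \<rho>\<^sub>2 z q) (aw_par_plus \<rho>\<^sub>2 z q) (complex_of_real q))
         (x * complex_of_real (sqrt (1 - q)) / 2)"

end

theory Submission
  imports Defs "HOL-Complex_Analysis.Complex_Analysis"
begin

text \<open>
  With \<open>2 x = z + 1 / z\<close>, both sums on the right-hand sides equal
  \<open>S\<^sub>n(z) = \<Sum>\<^sub>k [n, k]\<^sub>q (az)\<^sub>k (bz)\<^sub>k / ((ab)\<^sub>k z\<^sup>k) \<cdot> (c/z)\<^sub>m (d/z)\<^sub>m z\<^sup>m / (cd)\<^sub>m\<close> with \<open>m = n - k\<close>: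
  the generating function of every factor solves a \<open>q\<close>-difference equation, and multiplying by
  \<open>(tz)\<^sub>\<infinity> (t/z)\<^sub>\<infinity>\<close>, the generating function of the \<open>b\<^sub>n\<close>, cancels the factors \<open>1 / (tz)\<^sub>\<infinity>\<close> and
  \<open>1 / (t/z)\<^sub>\<infinity>\<close> in those of \<open>Q\<^sub>n(x|a,b,q) / (ab)\<^sub>n\<close> and \<open>Q\<^sub>n(x|c,d,q) / (cd)\<^sub>n\<close>. The leading coefficient of
  \<open>S\<^sub>n\<close> is a \<open>q\<close>-Vandermonde sum.

  Orthogonality is shown by induction on \<open>n\<close>. A telescoping identity writes \<open>(1/z - z) S\<^sub>n(z)\<close> as
  \<open>A(z) S\<^sub>n\<^sub>-\<^sub>1(s z) - A(1/z) S\<^sub>n\<^sub>-\<^sub>1(z/s)\<close> up to constants, where \<open>s\<^sup>2 = q\<close>, \<open>A\<close> is rational, and the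
  parameters on the right are multiplied by \<open>s\<close>. Integrating against the weight over the
  unit circle and moving the contour by the factor \<open>s\<close> through the annulus of analyticity turns
  the test polynomial \<open>g\<close> into the divided difference \<open>(g(z/s) - g(sz)) / (z - 1/z)\<close>, of smaller degree.
  For \<open>q = 0\<close> the integrand is holomorphic in the disc instead. Uniqueness holds because the weight is
  real and does not change sign.
\<close>

section \<open>Finite q-calculus\<close>

lemma qpoch_0 [simp]: "qpoch a q 0 = 1"
  by (simp add: qpoch_def)

lemma qpoch_Suc: "qpoch a q (Suc n) = qpoch a q n * (1 - a * q ^ n)"
  by (simp add: qpoch_def)

lemma qpoch_Suc_shift: "qpoch a q (Suc n) = (1 - a) * qpoch (a * q) q n"
  by (simp add: qpoch_def prod.lessThan_Suc_shift mult.assoc del: prod.lessThan_Suc)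

lemma one_minus_mult_power_neq_0:
  fixes a q :: complex
  assumes "norm q < 1" "norm a < 1"
  shows "1 - a * q ^ n \<noteq> 0"
proof
  assume "1 - a * q ^ n = 0"
  then have "norm a * norm q ^ n = 1"
    by (metis eq_iff_diff_eq_0 norm_mult norm_power norm_one)
  moreover have "norm a * norm q ^ n \<le> norm a * 1"
    using assms by (intro mult_left_mono power_le_one) auto
  ultimately show False using assms by simp
qed

lemma qpoch_nonzero:
  assumes "norm q < 1" "norm a < 1"
  shows "qpoch a q n \<noteq> 0"
  using one_minus_mult_power_neq_0[OF assms] by (simp add: qpoch_def)

lemma norm_mult_less_1:
  fixes a b :: complex
  assumes "norm a < 1" "norm b < 1"
  shows "norm (a * b) < 1"
  using assms mult_strict_mono[of "norm a" 1 "norm b" 1] by (simp add: norm_mult)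

lemma qnum_eq: "(1 - q) * qnum q n = 1 - q ^ n"
  by (simp add: qnum_def one_diff_power_eq)

text \<open>Each \<open>qnum q i\<close> absorbs one factor \<open>1 - q\<close> and becomes
  \<open>1 - q ^ i\<close>. This trades q-factorials for \<open>qpoch q q\<close>, in terms of which
  the later computations are made.\<close>

lemma qfact_eq: "(1 - q) ^ n * qfact q n = qpoch q q n"
proof (induction n)
  case (Suc n)
  have "(1 - q) ^ Suc n * qfact q (Suc n) = ((1 - q) ^ n * qfact q n) * ((1 - q) * qnum q (Suc n))"
    by (simp add: qfact_def)
  then show ?case
    by (simp only: Suc qnum_eq) (simp add: qpoch_Suc)
qed (simp add: qfact_def)

lemma qbinom_qpoch:
  assumes "norm q < 1" "k \<le> n"
  shows "qbinom q n k = qpoch q q n / (qpoch q q k * qpoch q q (n - k))"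
proof -
  have "1 - q \<noteq> 0"
    using assms by auto
  then have "qpoch q q n / (qpoch q q k * qpoch q q (n - k)) =
      ((1 - q) ^ n * qfact q n) / (((1 - q) ^ k * (1 - q) ^ (n - k)) * (qfact q k * qfact q (n - k)))"
    by (simp add: mult_ac flip: qfact_eq)
  also have "(1 - q) ^ k * (1 - q) ^ (n - k) = (1 - q) ^ n"
    using \<open>k \<le> n\<close> by (simp flip: power_add)
  finally show ?thesis
    using \<open>1 - q \<noteq> 0\<close> \<open>k \<le> n\<close> by (simp add: qbinom_def)
qed

lemma qbinom_sym: "k \<le> n \<Longrightarrow> qbinom q n (n - k) = qbinom q n k"
  by (simp add: qbinom_def mult.commute)

lemma qbinom_0 [simp]: "norm q < 1 \<Longrightarrow> qbinom q n 0 = 1"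
  and qbinom_self [simp]: "norm q < 1 \<Longrightarrow> qbinom q n n = 1"
  by (simp_all add: qbinom_qpoch qpoch_nonzero)

lemma qbinom_gt [simp]: "k > n \<Longrightarrow> qbinom q n k = 0"
  by (simp add: qbinom_def)

text \<open>The two q-Pascal rules. They differ in which term carries the power of \<open>q\<close>;
  the raising relation combines one of each.\<close>

lemma qbinom_Suc_Suc:
  assumes "norm q < 1" "k \<le> n"
  shows "qbinom q (Suc n) (Suc k) = q ^ (n - k) * qbinom q n k + qbinom q n (Suc k)" (is ?A)
    and "qbinom q (Suc n) (Suc k) = qbinom q n k + q ^ Suc k * qbinom q n (Suc k)" (is ?B)
proof -
  have "?A \<and> ?B"
  \<comment> \<open>For \<open>k = n\<close> the value of \<open>qbinom q n (Suc k)\<close> is the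
    default 0, which the quotient formula does not cover.\<close>
  proof (cases "k = n")
    case False
    then obtain m where n: "n = Suc (k + m)"
      using \<open>k \<le> n\<close> by (metis le_neq_implies_less less_iff_Suc_add)
    have nz: "qpoch q q i \<noteq> 0" "1 - q * q ^ i \<noteq> 0" for i
      by (rule qpoch_nonzero one_minus_mult_power_neq_0; fact assms)+
    have *: "qbinom q (Suc n) (Suc k) =
              qpoch q q n * (1 - q * q ^ n) / (qpoch q q k * (1 - q * q ^ k) * (qpoch q q m * (1 - q * q ^ m)))"
            "qbinom q n k = qpoch q q n / (qpoch q q k * (qpoch q q m * (1 - q * q ^ m)))"
            "qbinom q n (Suc k) = qpoch q q n / (qpoch q q k * (1 - q * q ^ k) * qpoch q q m)"
      using assms by (simp_all add: qbinom_qpoch n qpoch_Suc)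
    have q: "q ^ (n - k) = q * q ^ m" "q ^ n = q * q ^ k * q ^ m" "q ^ Suc k = q * q ^ k"
      by (simp_all add: n power_add mult_ac)
    show ?thesis
      unfolding * q using nz[of k] nz[of m] by (simp add: divide_simps) (simp add: algebra_simps)
  qed (use assms in auto)
  then show ?A ?B by auto
qed

text \<open>The q-Pascal rules summed against an arbitrary \<open>F\<close>. Folding a sum of level
  \<open>Suc n\<close> into one of level \<open>n\<close> drives the induction in
  \<open>q_Vandermonde\<close> and the telescoping in \<open>aw_raising\<close>.\<close>

lemma sum_qbinom_Suc:
  assumes "norm q < 1"
  shows "(\<Sum>k=0..Suc n. qbinom q (Suc n) k * F k) =
           (\<Sum>k=0..n. qbinom q n k * (q ^ (n - k) * F (Suc k) + F k))" (is "?L = ?A")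
    and "(\<Sum>k=0..Suc n. qbinom q (Suc n) k * F k) =
           (\<Sum>k=0..n. qbinom q n k * (F (Suc k) + q ^ k * F k))" (is "_ = ?B")
proof -
  \<comment> \<open>The summand at \<open>k = Suc n\<close> is zero, so the range may be extended by
    one before the first term is split off.\<close>
  have tail: "(\<Sum>k=0..n. qbinom q n k * G k) = G 0 + (\<Sum>k=0..n. qbinom q n (Suc k) * G (Suc k))" for G
  proof -
    have "(\<Sum>k=0..Suc n. qbinom q n k * G k) = G 0 + (\<Sum>k=0..n. qbinom q n (Suc k) * G (Suc k))"
      by (subst sum.atLeast0_atMost_Suc_shift) (use assms in simp)
    then show ?thesis
      by simp
  qed
  have L: "?L = F 0 + (\<Sum>k=0..n. qbinom q (Suc n) (Suc k) * F (Suc k))"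
    by (subst sum.atLeast0_atMost_Suc_shift) (use assms in simp)
  have "?L = F 0 + (\<Sum>k=0..n. (q ^ (n - k) * qbinom q n k + qbinom q n (Suc k)) * F (Suc k))"
    unfolding L by (intro arg_cong2[of _ _ _ _ "(+)"] refl sum.cong) (use assms in \<open>simp add: qbinom_Suc_Suc(1)\<close>)
  also have "\<dots> = (\<Sum>k=0..n. qbinom q n k * (q ^ (n - k) * F (Suc k)))
                   + (F 0 + (\<Sum>k=0..n. qbinom q n (Suc k) * F (Suc k)))"
    by (simp add: algebra_simps sum.distrib)
  also have "\<dots> = ?A"
    by (subst tail[symmetric]) (simp add: algebra_simps sum.distrib)
  finally show "?L = ?A" .
  have "?L = F 0 + (\<Sum>k=0..n. (qbinom q n k + q ^ Suc k * qbinom q n (Suc k)) * F (Suc k))"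
    unfolding L by (intro arg_cong2[of _ _ _ _ "(+)"] refl sum.cong) (use assms in \<open>simp add: qbinom_Suc_Suc(2)\<close>)
  also have "\<dots> = (\<Sum>k=0..n. qbinom q n k * F (Suc k))
                   + (F 0 + (\<Sum>k=0..n. qbinom q n (Suc k) * (q ^ Suc k * F (Suc k))))"
    by (simp add: algebra_simps sum.distrib)
  also have "\<dots> = ?B"
    using tail[of "\<lambda>k. q ^ k * F k"] by (simp add: algebra_simps sum.distrib)
  finally show "?L = ?B" .
qed

section \<open>Generating functions\<close>

text \<open>With the denominators \<open>qpoch q q n\<close>, the product of two generating
  functions corresponds to the q-binomial convolution of the sequences, which is the shape of all
  sums in the theorem.\<close>

definition qgf :: "complex \<Rightarrow> (nat \<Rightarrow> complex) \<Rightarrow> complex fps" where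
  "qgf q f = Abs_fps (\<lambda>n. f n / qpoch q q n)"

lemma qgf_nth [simp]: "qgf q f $ n = f n / qpoch q q n"
  by (simp add: qgf_def)

lemma qgf_mult:
  assumes "norm q < 1"
  shows "qgf q f * qgf q g = qgf q (\<lambda>n. \<Sum>k=0..n. qbinom q n k * (f k * g (n - k)))"
proof (rule fps_ext)
  fix n
  have "f k / qpoch q q k * (g (n - k) / qpoch q q (n - k)) =
        qbinom q n k * (f k * g (n - k)) / qpoch q q n" if "k \<le> n" for k
    using qbinom_qpoch[OF assms that] qpoch_nonzero[OF assms assms] by simp
  then show "(qgf q f * qgf q g) $ n = qgf q (\<lambda>n. \<Sum>k=0..n. qbinom q n k * (f k * g (n - k))) $ n"
    by (simp add: fps_mult_nth sum_divide_distrib)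
qed

lemma qgf_cong_iff: "norm q < 1 \<Longrightarrow> qgf q f = qgf q g \<longleftrightarrow> (\<forall>n. f n = g n)"
  by (simp add: fps_eq_iff qpoch_nonzero)

section \<open>Dilation and q-difference operators on formal power series\<close>

definition fps_dilate :: "complex \<Rightarrow> complex fps \<Rightarrow> complex fps" where
  "fps_dilate q f = Abs_fps (\<lambda>n. q ^ n * f $ n)"

lemma fps_dilate_nth [simp]: "fps_dilate q f $ n = q ^ n * f $ n"
  by (simp add: fps_dilate_def)

lemma fps_dilate_mult: "fps_dilate q (f * g) = fps_dilate q f * fps_dilate q g"
  by (rule fps_ext)
    (auto simp: fps_mult_nth sum_distrib_left simp flip: power_add intro!: sum.cong)

lemma fps_dilate_add [simp]: "fps_dilate q (f + g) = fps_dilate q f + fps_dilate q g"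
  and fps_dilate_diff [simp]: "fps_dilate q (f - g) = fps_dilate q f - fps_dilate q g"
  and fps_dilate_minus [simp]: "fps_dilate q (- f) = - fps_dilate q f"
  and fps_dilate_const [simp]: "fps_dilate q (fps_const c) = fps_const c"
  and fps_dilate_one [simp]: "fps_dilate q 1 = 1"
  and fps_dilate_X: "fps_dilate q fps_X = fps_const q * fps_X"
  by (auto simp: fps_eq_iff algebra_simps fps_X_def)

text \<open>The \<open>q\<close>-difference quotient \<open>(f(t) - f(q t)) / t\<close>.\<close>

definition fps_qdiff :: "complex \<Rightarrow> complex fps \<Rightarrow> complex fps" where
  "fps_qdiff q f = Abs_fps (\<lambda>n. (1 - q ^ Suc n) * f $ Suc n)"

lemma fps_qdiff_nth [simp]: "fps_qdiff q f $ n = (1 - q ^ Suc n) * f $ Suc n"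
  by (simp add: fps_qdiff_def)

lemma fps_X_qdiff: "fps_X * fps_qdiff q f = f - fps_dilate q f"
proof (rule fps_ext)
  fix n show "(fps_X * fps_qdiff q f) $ n = (f - fps_dilate q f) $ n"
    by (cases n) (simp_all add: algebra_simps)
qed

text \<open>The factor \<open>1 - q ^ Suc n\<close> cancels against the last factor of
  \<open>qpoch q q (Suc n)\<close>, so on these generating functions the q-difference quotient is
  the index shift.\<close>

lemma fps_qdiff_qgf_nth:
  assumes "norm q < 1"
  shows "fps_qdiff q (qgf q f) $ n = f (Suc n) / qpoch q q n"
  using qpoch_nonzero[OF assms assms, of n] one_minus_mult_power_neq_0[OF assms assms, of n]
  by (simp add: qpoch_Suc)

text \<open>The q-Leibniz rule: after multiplication by the variable it says \<open>f(t) g(t) -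
  f(qt) g(qt) = g(t) (f(t) - f(qt)) + f(qt) (g(t) - g(qt))\<close>, and \<open>fps_X\<close> can be
  cancelled.\<close>

lemma fps_qdiff_mult: "fps_qdiff q (f * g) = g * fps_qdiff q f + fps_dilate q f * fps_qdiff q g"
proof -
  have "fps_X * fps_qdiff q (f * g) =
        g * (fps_X * fps_qdiff q f) + fps_dilate q f * (fps_X * fps_qdiff q g)"
    unfolding fps_X_qdiff by (simp add: fps_dilate_mult algebra_simps)
  then have "fps_X * fps_qdiff q (f * g) =
        fps_X * (g * fps_qdiff q f + fps_dilate q f * fps_qdiff q g)"
    by (simp add: algebra_simps)
  then show ?thesis
    by simp
qed

text \<open>The generating functions of \<open>z ^ n\<close> and of \<open>(-1) ^ n q ^ (n choose 2) z ^ n\<close> are the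
  \<open>q\<close>-exponentials \<open>1 / (t z)\<^sub>\<infinity>\<close> and \<open>(t z)\<^sub>\<infinity>\<close>.\<close>

definition qexp :: "complex \<Rightarrow> complex \<Rightarrow> complex fps" where
  "qexp q z = qgf q (\<lambda>n. z ^ n)"

definition qExp :: "complex \<Rightarrow> complex \<Rightarrow> complex fps" where
  "qExp q z = qgf q (\<lambda>n. (-1) ^ n * q ^ (n choose 2) * z ^ n)"

lemma qdiff_qexp: "norm q < 1 \<Longrightarrow> fps_qdiff q (qexp q z) = fps_const z * qexp q z"
  unfolding qexp_def by (intro fps_ext) (simp add: fps_qdiff_qgf_nth del: fps_qdiff_nth)

lemma choose_two_Suc: "Suc n choose 2 = (n choose 2) + n"
  by (simp add: numeral_2_eq_2)

lemma qdiff_qExp: "norm q < 1 \<Longrightarrow> fps_qdiff q (qExp q z) = - fps_const z * fps_dilate q (qExp q z)"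
  unfolding qExp_def
  by (intro fps_ext) (simp add: fps_qdiff_qgf_nth choose_two_Suc power_add del: fps_qdiff_nth)

lemma dilate_qexp:
  assumes "norm q < 1"
  shows "fps_dilate q (qexp q z) = (1 - fps_const z * fps_X) * qexp q z"
  using fps_X_qdiff[of q "qexp q z"] qdiff_qexp[OF assms, of z] by (simp add: algebra_simps)

lemma qExp_dilate:
  assumes "norm q < 1"
  shows "qExp q z = (1 - fps_const z * fps_X) * fps_dilate q (qExp q z)"
  using fps_X_qdiff[of q "qExp q z"]
  by (simp add: qdiff_qExp[OF assms, of z] algebra_simps add_eq_0_iff flip: fps_const_neg)

text \<open>Under dilation the factor \<open>1 - z t\<close> gained by one function is lost by the
  other, so the product is invariant. Since \<open>1 - q ^ n\<close> is nonzero for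
  \<open>n > 0\<close>, only the constant coefficient survives.\<close>

lemma qExp_qexp:
  assumes "norm q < 1"
  shows "qExp q z * qexp q z = 1"
proof (rule fps_ext)
  fix n
  let ?p = "qExp q z * qexp q z"
  have "fps_dilate q ?p = (1 - fps_const z * fps_X) * fps_dilate q (qExp q z) * qexp q z"
    by (simp add: fps_dilate_mult dilate_qexp[OF assms] mult_ac)
  also have "\<dots> = ?p"
    by (simp flip: qExp_dilate[OF assms])
  finally have "(1 - q ^ n) * ?p $ n = 0"
    by (metis (no_types, lifting) fps_dilate_nth left_diff_distrib mult_1 right_minus_eq)
  moreover have "1 - q ^ n \<noteq> 0" if "n > 0"
    using that one_minus_mult_power_neq_0[OF assms assms, of "n - 1"]
    by (simp flip: power_Suc)
  ultimately show "?p $ n = 1 $ n"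
    by (cases "n = 0") (auto simp: qExp_def qexp_def numeral_2_eq_2)
qed

section \<open>Al-Salam--Chihara polynomials and their duals\<close>

text \<open>This is what remains of \<open>asc_Q n x a b q / qpoch (a * b) q n\<close> when the
  factor \<open>qexp q z\<close> is split off its generating function, with
  \<open>2 x = z + 1 / z\<close>; see \<open>qgf_asc_Q\<close>.\<close>

definition aw_half :: "complex \<Rightarrow> complex \<Rightarrow> complex \<Rightarrow> complex \<Rightarrow> nat \<Rightarrow> complex" where
  "aw_half q a b z k = qpoch (a * z) q k * qpoch (b * z) q k / (qpoch (a * b) q k * z ^ k)"

lemma aw_half_0 [simp]: "aw_half q a b z 0 = 1"
  by (simp add: aw_half_def)

text \<open>The two new numerator factors multiply to a quadratic polynomial in
  \<open>q ^ k\<close>. In \<open>qdiff_aw_half\<close> each power of \<open>q ^ k\<close> becomes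
  one application of \<open>fps_dilate\<close>.\<close>

lemma aw_half_Suc:
  assumes "z \<noteq> 0" "1 - a * b * q ^ k \<noteq> 0"
  shows "(1 - a * b * q ^ k) * aw_half q a b z (Suc k) =
           (1 / z - (a + b) * q ^ k + a * b * z * (q ^ k * q ^ k)) * aw_half q a b z k"
proof -
  have "1 / z - (a + b) * q ^ k + a * b * z * (q ^ k * q ^ k) =
        (1 - a * z * q ^ k) * (1 - b * z * q ^ k) / z"
    using assms by (simp add: field_simps)
  then show ?thesis
    using assms by (simp add: aw_half_def qpoch_Suc mult_ac)
qed

lemma qdiff_aw_half:
  fixes a b z :: complex
  assumes "norm q < 1" "norm (a * b) < 1" "z \<noteq> 0"
  defines "f \<equiv> qgf q (aw_half q a b z)"
  shows "fps_qdiff q f - fps_const (a * b) * fps_dilate q (fps_qdiff q f) =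
           fps_const (1 / z) * f - fps_const (a + b) * fps_dilate q f
           + fps_const (a * b * z) * fps_dilate q (fps_dilate q f)" (is "?l = ?r")
proof (rule fps_ext)
  fix n
  have "?l $ n = (1 - a * b * q ^ n) * aw_half q a b z (Suc n) / qpoch q q n"
    using assms by (simp add: f_def fps_qdiff_qgf_nth algebra_simps diff_divide_distrib del: fps_qdiff_nth)
  also have "\<dots> = ?r $ n"
    using one_minus_mult_power_neq_0[OF assms(1,2), of n]
    by (subst aw_half_Suc[OF assms(3)])
       (simp_all add: f_def algebra_simps add_divide_distrib diff_divide_distrib)
  finally show "?l $ n = ?r $ n" .
qed

text \<open>Up to the factor \<open>(-1) ^ n q ^ (n choose 2)\<close>, these are Al-Salam--Chihara polynomials for the
  base \<open>1/q\<close>; the recurrence makes sense for \<open>q = 0\<close> as well.\<close>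

fun asc_dual :: "nat \<Rightarrow> complex \<Rightarrow> complex \<Rightarrow> complex \<Rightarrow> complex \<Rightarrow> complex" where
  "asc_dual 0 x a b q = 1"
| "asc_dual (Suc 0) x a b q = (a + b) - 2 * x * (a * b)"
| "asc_dual (Suc (Suc n)) x a b q =
     ((a + b) - 2 * x * (a * b) * q ^ Suc n) * asc_dual (Suc n) x a b q
     - (1 - a * b * q ^ n) * (1 - q ^ Suc n) * (a * b) * asc_dual n x a b q"

lemma qpoch_self_Suc: "qpoch q q (Suc n) = qpoch q q n * (1 - q ^ Suc n)"
  by (simp add: qpoch_Suc)

text \<open>Undoes the normalisation of \<open>qgf\<close>, so that a q-difference equation can be
  read off as a recurrence.\<close>

definition qcoeff :: "complex \<Rightarrow> complex fps \<Rightarrow> nat \<Rightarrow> complex" where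
  "qcoeff q F n = F $ n * qpoch q q n"

lemma qcoeff_simps:
  assumes "norm q < 1"
  shows "qcoeff q (qgf q w) n = w n"
    "qcoeff q (F + G) n = qcoeff q F n + qcoeff q G n"
    "qcoeff q (F - G) n = qcoeff q F n - qcoeff q G n"
    "qcoeff q (- F) n = - qcoeff q F n"
    "qcoeff q (fps_const k * F) n = k * qcoeff q F n"
    "qcoeff q (fps_dilate q F) n = q ^ n * qcoeff q F n"
    "qcoeff q (fps_qdiff q F) n = qcoeff q F (Suc n)"
    "qcoeff q (fps_X * F) n = (if n = 0 then 0 else (1 - q ^ n) * qcoeff q F (n - 1))"
  using qpoch_nonzero[OF assms assms]
  by (auto simp: qcoeff_def qpoch_self_Suc gr0_conv_Suc algebra_simps)

text \<open>The product on the right solves a q-difference equation whose coefficients give the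
  three-term recurrence of the Al-Salam--Chihara polynomials divided by
  \<open>qpoch (a * b) q n\<close>.\<close>

lemma qgf_asc_Q:
  assumes "norm q < 1" "norm (a * b) < 1" "z \<noteq> 0" "2 * x = z + 1 / z"
  shows "qgf q (\<lambda>n. asc_Q n x a b q / qpoch (a * b) q n) = qgf q (aw_half q a b z) * qexp q z"
proof -
  define f where "f = qgf q (aw_half q a b z)"
  define g where "g = qexp q z"
  define w where "w n = (\<Sum>k=0..n. qbinom q n k * (aw_half q a b z k * z ^ (n - k)))" for n
  have fg: "f * g = qgf q w"
    using assms(1) by (simp add: f_def g_def qexp_def qgf_mult w_def[abs_def])
  let ?c = fps_const
  let ?\<eta> = "fps_dilate q"
  have Z: "?c z * ?c (1 / z) = 1"
    using assms by simp
  have f: "fps_qdiff q f - ?c (a * b) * ?\<eta> (fps_qdiff q f) =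
           ?c (1 / z) * f - ?c (a + b) * ?\<eta> f + ?c (a * b) * ?c z * ?\<eta> (?\<eta> f)"
    using qdiff_aw_half[OF assms(1-3)] by (simp add: f_def)
  have v: "fps_qdiff q (f * g) = g * fps_qdiff q f + ?\<eta> f * (?c z * g)"
    using assms by (simp add: fps_qdiff_mult qdiff_qexp g_def)
  have \<eta>g: "?\<eta> g = (1 - ?c z * fps_X) * g"
    unfolding g_def by (rule dilate_qexp[OF assms(1)])
  \<comment> \<open>Multiplying by \<open>g\<close> makes the equation of \<open>f\<close> symmetric
    in \<open>z\<close> and \<open>1 / z\<close>: only \<open>z + 1 / z = 2 * x\<close> is left, and
    the second dilation of \<open>f\<close> is replaced by a multiplication by
    \<open>fps_X\<close>.\<close>
  have eq: "fps_qdiff q (f * g) - ?c (a * b) * ?\<eta> (fps_qdiff q (f * g)) =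
        (?c z + ?c (1 / z)) * (f * g) - ?c (a + b) * ?\<eta> (f * g) - fps_X * (f * g)"
    unfolding v fps_dilate_add fps_dilate_mult fps_dilate_const \<eta>g
    using f Z fps_X_qdiff[of q f] by algebra
  have rec: "(1 - a * b * q ^ n) * w (Suc n) =
      (2 * x - (a + b) * q ^ n) * w n - (if n = 0 then 0 else (1 - q ^ n) * w (n - 1))" for n
    using arg_cong[OF eq, of "\<lambda>F. qcoeff q F n"]
    unfolding fg
    by (simp add: qcoeff_simps[OF assms(1)] assms(4) distrib_right left_diff_distrib mult.assoc
          del: fps_const_add fps_const_mult)
  \<comment> \<open>Two consecutive indices are carried through the induction because the recurrence
    has three terms.\<close>
  have "asc_Q n x a b q = qpoch (a * b) q n * w n \<and>
        asc_Q (Suc n) x a b q = qpoch (a * b) q (Suc n) * w (Suc n)" for n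
  proof (induction n)
    case 0
    then show ?case
      using rec[of 0] assms(1) by (simp add: qpoch_Suc w_def)
  next
    case (Suc n)
    have "qpoch (a * b) q (Suc (Suc n)) * w (Suc (Suc n)) =
        qpoch (a * b) q (Suc n) * ((1 - a * b * q ^ Suc n) * w (Suc (Suc n)))"
      by (simp add: qpoch_Suc)
    also have "\<dots> = (2 * x - (a + b) * q ^ Suc n) * (qpoch (a * b) q (Suc n) * w (Suc n))
        - (1 - a * b * q ^ n) * (1 - q ^ Suc n) * (qpoch (a * b) q n * w n)"
      unfolding rec by (simp add: qpoch_Suc algebra_simps)
    finally show ?case
      using Suc by simp
  qed
  then have "asc_Q n x a b q / qpoch (a * b) q n = w n" for n
    using qpoch_nonzero[OF assms(1,2)] by simp
  then show ?thesis
    using fg by (simp add: f_def g_def)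
qed

text \<open>The two q-exponentials are \<open>(t z)\<close> and \<open>(t / z)\<close> infinite
  q-Pochhammer symbols; the equation of their product is again symmetric in \<open>z\<close> and
  \<open>1 / z\<close> and yields the recurrence of \<open>small_b\<close>.\<close>

lemma qgf_small_b:
  assumes "norm q < 1" "z \<noteq> 0" "2 * x = z + 1 / z"
  shows "qgf q (\<lambda>n. small_b n x q) = qExp q z * qExp q (1 / z)"
proof -
  define e where "e = qExp q z"
  define e' where "e' = qExp q (1 / z)"
  define w where "w n = (\<Sum>k=0..n. qbinom q n k * (((-1) ^ k * q ^ (k choose 2) * z ^ k)
    * ((-1) ^ (n - k) * q ^ ((n - k) choose 2) * (1 / z) ^ (n - k))))" for n
  have ee: "e * e' = qgf q w"
    using assms(1) by (simp add: e_def e'_def qExp_def qgf_mult w_def[abs_def])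
  let ?c = fps_const
  let ?\<eta> = "fps_dilate q"
  have Z: "?c z * ?c (1 / z) = 1"
    using assms by simp
  have q: "fps_qdiff q e = - ?c z * ?\<eta> e" "fps_qdiff q e' = - ?c (1 / z) * ?\<eta> e'"
    unfolding e_def e'_def by (rule qdiff_qExp[OF assms(1)])+
  \<comment> \<open>The q-Leibniz rule leaves one undilated \<open>e'\<close>; this relation
    expresses it by its dilation, so that the equation involves the dilated product only.\<close>
  have e': "e' = (1 - ?c (1 / z) * fps_X) * ?\<eta> e'"
    unfolding e'_def by (rule qExp_dilate[OF assms(1)])
  have "fps_qdiff q (e * e') = - (?c z + ?c (1 / z)) * ?\<eta> (e * e') + fps_X * ?\<eta> (e * e')"
    unfolding fps_qdiff_mult fps_dilate_mult q using e' Z by algebra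
  then have eq: "fps_qdiff q (qgf q w) = - (?c z + ?c (1 / z)) * ?\<eta> (qgf q w) + fps_X * ?\<eta> (qgf q w)"
    by (simp only: ee)
  have rec: "w (Suc n) = - 2 * x * q ^ n * w n
      + (if n = 0 then 0 else q ^ (n - 1) * (1 - q ^ n) * w (n - 1))" for n
    using arg_cong[OF eq, of "\<lambda>F. qcoeff q F n"]
    by (simp add: qcoeff_simps[OF assms(1)] assms(3) distrib_right left_diff_distrib mult.assoc
          del: fps_const_add fps_const_mult fps_const_neg)
       (simp add: algebra_simps)
  have "small_b n x q = w n \<and> small_b (Suc n) x q = w (Suc n)" for n
  proof (induction n)
    case 0
    then show ?case
      using rec[of 0] assms(1) by (simp add: w_def numeral_2_eq_2)
  next
    case (Suc n)
    then show ?case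
      by (simp add: rec[of "Suc n"])
  qed
  then show ?thesis
    using ee by (simp add: e_def e'_def)
qed

text \<open>The factor \<open>qExp q (1 / z)\<close> is chosen to cancel the
  \<open>qexp q (1 / z)\<close> that \<open>qgf_asc_Q\<close> contributes for the parameters
  \<open>c\<close>, \<open>d\<close> at \<open>1 / z\<close>. This is the source of the single sum
  in part (iii).\<close>

lemma qgf_asc_dual:
  assumes "norm q < 1" "norm (a * b) < 1" "z \<noteq> 0" "2 * x = z + 1 / z"
  shows "qgf q (\<lambda>n. (-1) ^ n * q ^ (n choose 2) * asc_dual n x a b q / qpoch (a * b) q n) =
           qExp q (1 / z) * qgf q (aw_half q a b z)"
proof -
  define f where "f = qgf q (aw_half q a b z)"
  define e where "e = qExp q (1 / z)"
  define w where "w n = (\<Sum>k=0..n. qbinom q n k *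
    ((-1) ^ k * q ^ (k choose 2) * (1 / z) ^ k * aw_half q a b z (n - k)))" for n
  have ef: "e * f = qgf q w"
    using assms(1) by (simp add: f_def e_def qExp_def qgf_mult w_def[abs_def])
  let ?c = fps_const
  let ?\<eta> = "fps_dilate q"
  have Z: "?c z * ?c (1 / z) = 1"
    using assms by simp
  have f: "fps_qdiff q f - ?c (a * b) * ?\<eta> (fps_qdiff q f) =
           ?c (1 / z) * f - ?c (a + b) * ?\<eta> f + ?c (a * b) * ?c z * ?\<eta> (?\<eta> f)"
    using qdiff_aw_half[OF assms(1-3)] by (simp add: f_def)
  have Xf: "?c q * fps_X * ?\<eta> (fps_qdiff q f) = ?\<eta> f - ?\<eta> (?\<eta> f)"
    using arg_cong[OF fps_X_qdiff[of q f], of ?\<eta>] by (simp add: fps_dilate_mult fps_dilate_X)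
  have qe: "fps_qdiff q e = - ?c (1 / z) * ?\<eta> e"
    unfolding e_def by (rule qdiff_qExp[OF assms(1)])
  have "e = (1 - ?c (1 / z) * fps_X) * ?\<eta> e"
    unfolding e_def by (rule qExp_dilate[OF assms(1)])
  from arg_cong[OF this, of ?\<eta>] have \<eta>e: "?\<eta> e = (1 - ?c (1 / z) * (?c q * fps_X)) * ?\<eta> (?\<eta> e)"
    by (simp add: fps_dilate_mult fps_dilate_X)
  have "fps_qdiff q (e * f) - ?c (a * b) * ?\<eta> (fps_qdiff q (e * f)) =
        - ?c (a + b) * ?\<eta> (e * f) + (?c z + ?c (1 / z)) * ?c (a * b) * ?\<eta> (?\<eta> (e * f))
        - ?c (a * b) * ?c q * fps_X * ?\<eta> (?\<eta> (e * f))"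
    unfolding fps_qdiff_mult qe fps_dilate_add fps_dilate_mult fps_dilate_minus fps_dilate_const
    using f Z Xf \<eta>e by algebra
  then have eq: "fps_qdiff q (qgf q w) - ?c (a * b) * ?\<eta> (fps_qdiff q (qgf q w)) =
        - ?c (a + b) * ?\<eta> (qgf q w) + (?c z + ?c (1 / z)) * ?c (a * b) * ?\<eta> (?\<eta> (qgf q w))
        - ?c (a * b) * ?c q * fps_X * ?\<eta> (?\<eta> (qgf q w))"
    by (simp only: ef)
  have rec: "(1 - a * b * q ^ n) * w (Suc n) =
      - (q ^ n) * (((a + b) - 2 * x * (a * b) * q ^ n) * w n
        + (if n = 0 then 0 else q ^ (n - 1) * (1 - q ^ n) * (a * b) * w (n - 1)))" for n
    using arg_cong[OF eq, of "\<lambda>F. qcoeff q F n"]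
    by (cases n; simp add: qcoeff_simps[OF assms(1)] assms(4) distrib_right left_diff_distrib mult.assoc
          del: fps_const_add fps_const_mult fps_const_neg)
       (simp add: algebra_simps)+
  \<comment> \<open>With the sign and the power of \<open>q\<close> included, the dual polynomials
    obey the recurrence of \<open>qpoch (a * b) q n * w n\<close>.\<close>
  define u where "u n = (-1) ^ n * q ^ (n choose 2) * asc_dual n x a b q" for n
  have u: "u (Suc (Suc n)) = - (q ^ Suc n) * (((a + b) - 2 * x * (a * b) * q ^ Suc n) * u (Suc n)
      + q ^ n * (1 - a * b * q ^ n) * (1 - q ^ Suc n) * (a * b) * u n)" for n
    by (simp add: u_def choose_two_Suc power_add algebra_simps)
  have "u n = qpoch (a * b) q n * w n \<and> u (Suc n) = qpoch (a * b) q (Suc n) * w (Suc n)" for n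
  proof (induction n)
    case 0
    then show ?case
      using rec[of 0] assms(1) by (simp add: qpoch_Suc w_def u_def numeral_2_eq_2)
  next
    case (Suc n)
    have "qpoch (a * b) q (Suc (Suc n)) * w (Suc (Suc n)) =
        qpoch (a * b) q (Suc n) * ((1 - a * b * q ^ Suc n) * w (Suc (Suc n)))"
      by (simp add: qpoch_Suc)
    also have "\<dots> = - (q ^ Suc n) * (((a + b) - 2 * x * (a * b) * q ^ Suc n) * (qpoch (a * b) q (Suc n) * w (Suc n))
      + q ^ n * (1 - a * b * q ^ n) * (1 - q ^ Suc n) * (a * b) * (qpoch (a * b) q n * w n))"
      unfolding rec by (simp add: qpoch_Suc algebra_simps)
    finally show ?case
      using Suc u by simp
  qed
  then have "u n / qpoch (a * b) q n = w n" for n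
    using qpoch_nonzero[OF assms(1,2)] by simp
  then show ?thesis
    using ef by (simp add: f_def e_def u_def)
qed

section \<open>The three sum formulas\<close>

definition aw_sum :: "complex \<Rightarrow> complex \<Rightarrow> complex \<Rightarrow> complex \<Rightarrow> complex \<Rightarrow> complex \<Rightarrow> nat \<Rightarrow> complex" where
  "aw_sum q a b c d z n =
     (\<Sum>k=0..n. qbinom q n k * (aw_half q a b z k * aw_half q c d (1 / z) (n - k)))"

lemma aw_sum_eq_b_Q_Q:
  assumes "norm q < 1" "norm (a * b) < 1" "norm (c * d) < 1" "z \<noteq> 0" "2 * x = z + 1 / z"
  shows "(\<Sum>j=0..n. qbinom q n j * small_b (n - j) x q
            * (\<Sum>i=0..j. qbinom q j i * (asc_Q i x a b q * asc_Q (j - i) x c d q)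
                 / (qpoch (a * b) q i * qpoch (c * d) q (j - i)))) = aw_sum q a b c d z n"
proof -
  let ?u = "\<lambda>n. asc_Q n x a b q / qpoch (a * b) q n"
  let ?v = "\<lambda>n. asc_Q n x c d q / qpoch (c * d) q n"
  let ?b = "\<lambda>n. small_b n x q"
  have "(qgf q ?u * qgf q ?v) * qgf q ?b = qgf q (aw_half q a b z) * qexp q z *
      (qgf q (aw_half q c d (1 / z)) * qexp q (1 / z)) * (qExp q z * qExp q (1 / z))"
    using assms by (simp add: qgf_asc_Q[of q a b z] qgf_asc_Q[of q c d "1 / z"] qgf_small_b[of q z] add.commute)
  also have "\<dots> = qgf q (aw_half q a b z) * qgf q (aw_half q c d (1 / z)) *
      (qExp q z * qexp q z) * (qExp q (1 / z) * qexp q (1 / z))"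
    by (simp only: mult_ac)
  also have "\<dots> = qgf q (aw_sum q a b c d z)"
    using assms(1) by (simp add: qExp_qexp qgf_mult aw_sum_def[abs_def])
  finally have "(\<Sum>j=0..n. qbinom q n j * ((\<Sum>i=0..j. qbinom q j i * (?u i * ?v (j - i))) * ?b (n - j))) =
      aw_sum q a b c d z n"
    by (simp only: qgf_mult[OF assms(1)] qgf_cong_iff[OF assms(1)])
  then show ?thesis
    by (simp add: mult_ac)
qed

text \<open>Besides giving part (iii), this single sum is the form from which degree and leading
  coefficient of \<open>aw_sum\<close> are computed.\<close>

lemma aw_sum_eq_Q_dual:
  assumes "norm q < 1" "norm (a * b) < 1" "norm (c * d) < 1" "z \<noteq> 0" "2 * x = z + 1 / z"
  shows "(\<Sum>m=0..n. qbinom q n m * ((-1) ^ m * q ^ (m choose 2) * asc_dual m x a b q / qpoch (a * b) q m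
            * (asc_Q (n - m) x c d q / qpoch (c * d) q (n - m)))) = aw_sum q a b c d z n"
proof -
  let ?u = "\<lambda>n. (-1) ^ n * q ^ (n choose 2) * asc_dual n x a b q / qpoch (a * b) q n"
  let ?v = "\<lambda>n. asc_Q n x c d q / qpoch (c * d) q n"
  have "qgf q ?u * qgf q ?v = qExp q (1 / z) * qgf q (aw_half q a b z) *
      (qgf q (aw_half q c d (1 / z)) * qexp q (1 / z))"
    using assms by (simp add: qgf_asc_dual[of q a b z] qgf_asc_Q[of q c d "1 / z"] add.commute)
  also have "\<dots> = qgf q (aw_half q a b z) * qgf q (aw_half q c d (1 / z)) *
      (qExp q (1 / z) * qexp q (1 / z))"
    by (simp only: mult_ac)
  also have "\<dots> = qgf q (aw_sum q a b c d z)"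
    using assms(1) by (simp add: qExp_qexp qgf_mult aw_sum_def[abs_def])
  finally show ?thesis
    using assms(1) by (simp add: qgf_mult qgf_cong_iff)
qed

lemma qpoch_shift_eq: "a \<noteq> 1 \<Longrightarrow> qpoch (a * q) q n = qpoch a q (Suc n) / (1 - a)"
  by (simp add: qpoch_Suc_shift)

text \<open>A form of the q-Vandermonde sum, needed for the leading coefficient with
  \<open>A = a * b\<close> and \<open>C = c * d\<close>. The second q-Pascal rule lowers
  \<open>n\<close> by one while multiplying both parameters by \<open>q\<close>.\<close>

lemma q_Vandermonde:
  assumes "norm q < 1" "norm A < 1" "norm C < 1"
  shows "(\<Sum>k=0..n. qbinom q n k * (A ^ k * q ^ (k * (k - 1)) / (qpoch A q k * qpoch C q (n - k)))) =
           qpoch (A * C * q ^ (n - 1)) q n / (qpoch A q n * qpoch C q n)"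
  using assms(2,3)
proof (induction n arbitrary: A C)
  case (Suc n)
  define F where "F k = A ^ k * q ^ (k * (k - 1)) / (qpoch A q k * qpoch C q (Suc n - k))" for k
  define G where "G k = (A * q) ^ k * q ^ (k * (k - 1)) / (qpoch (A * q) q k * qpoch (C * q) q (n - k))" for k
  have nz: "1 - A \<noteq> 0" "1 - C \<noteq> 0"
    using Suc.prems by auto
  \<comment> \<open>Two neighbouring terms combine into a constant times the summand
    \<open>G k\<close> of the smaller sum with parameters \<open>A * q\<close> and
    \<open>C * q\<close>; the constant is the new factor of the closed form.\<close>
  have FG: "F (Suc k) + q ^ k * F k = (1 - A * C * q ^ n) / ((1 - A) * (1 - C)) * G k" if "k \<le> n" for k
  proof -
    define m where "m = n - k"
    have n: "q ^ n = q ^ k * q ^ m" "Suc n - k = Suc m"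
      using that by (simp_all add: m_def Suc_diff_le flip: power_add)
    have Suc: "qpoch A q (Suc k) = qpoch A q k * (1 - A * q ^ k)" "qpoch C q (Suc m) = qpoch C q m * (1 - C * q ^ m)"
      by (simp_all add: qpoch_Suc)
    have shift: "qpoch (A * q) q k = qpoch A q (Suc k) / (1 - A)" "qpoch (C * q) q m = qpoch C q (Suc m) / (1 - C)"
      using nz by (simp_all add: qpoch_Suc_shift)
    have nz': "qpoch A q k \<noteq> 0" "qpoch C q m \<noteq> 0" "1 - A * q ^ k \<noteq> 0" "1 - C * q ^ m \<noteq> 0"
      using Suc.prems assms(1) by (auto simp: qpoch_nonzero one_minus_mult_power_neq_0 simp del: right_minus_eq)
    have p: "q ^ (Suc k * (Suc k - 1)) = q ^ (k * (k - 1)) * q ^ k * q ^ k"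
      by (cases k) (simp_all add: power_add mult_ac)
    show ?thesis
      using nz nz' unfolding F_def G_def p
      by (simp add: n Suc shift power_mult_distrib flip: m_def)
         (simp add: divide_simps, simp add: algebra_simps)
  qed
  have "(\<Sum>k=0..Suc n. qbinom q (Suc n) k * F k) = (\<Sum>k=0..n. qbinom q n k * (F (Suc k) + q ^ k * F k))"
    by (rule sum_qbinom_Suc(2)[OF assms(1)])
  also have "\<dots> = (\<Sum>k=0..n. (1 - A * C * q ^ n) / ((1 - A) * (1 - C)) * (qbinom q n k * G k))"
    by (intro sum.cong refl) (simp add: FG)
  also have "\<dots> = (1 - A * C * q ^ n) / ((1 - A) * (1 - C)) * (\<Sum>k=0..n. qbinom q n k * G k)"
    by (simp add: sum_distrib_left)
  also have "(\<Sum>k=0..n. qbinom q n k * G k) =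
      qpoch (A * q * (C * q) * q ^ (n - 1)) q n / (qpoch (A * q) q n * qpoch (C * q) q n)"
    unfolding G_def using Suc.prems assms(1) by (intro Suc.IH norm_mult_less_1)
  \<comment> \<open>For \<open>n = 0\<close> the exponent \<open>n - 1\<close> is truncated to 0,
    which is harmless because both products are empty.\<close>
  also have "qpoch (A * q * (C * q) * q ^ (n - 1)) q n = qpoch (A * C * q ^ n * q) q n"
    by (cases n) (simp_all add: mult_ac)
  finally show ?case
    unfolding F_def by (simp add: qpoch_Suc_shift)
qed (use assms(1) in simp)

section \<open>The raising relation\<close>

text \<open>For \<open>s\<close> a nonzero square root of \<open>q\<close> this is
  \<open>s ^ n\<close> times \<open>aw_sum\<close> with \<open>z\<close> and all four parameters
  multiplied by \<open>s\<close> (\<open>aw_raise_sqrt\<close>). Written without \<open>s\<close>,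
  it keeps its meaning in the raising relation for \<open>q = 0\<close>.\<close>

definition aw_raise :: "complex \<Rightarrow> complex \<Rightarrow> complex \<Rightarrow> complex \<Rightarrow> complex \<Rightarrow> complex \<Rightarrow> nat \<Rightarrow> complex" where
  "aw_raise q a b c d z n =
     (\<Sum>k=0..n. qbinom q n k * (q ^ (n - k)
        * (qpoch (a * z * q) q k * qpoch (b * z * q) q k / (qpoch (a * b * q) q k * z ^ k))
        * (qpoch (c / z) q (n - k) * qpoch (d / z) q (n - k) * z ^ (n - k) / qpoch (c * d * q) q (n - k))))"

definition aw_factor :: "complex \<Rightarrow> complex \<Rightarrow> complex \<Rightarrow> complex \<Rightarrow> complex \<Rightarrow> complex" where
  "aw_factor a b c d z = (1 - a * z) * (1 - b * z) * (1 - c * z) * (1 - d * z) / z\<^sup>2"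

lemma aw_raise_sqrt:
  assumes "s\<^sup>2 = q" "z \<noteq> 0" "s \<noteq> 0"
  shows "aw_raise q a b c d z n = s ^ n * aw_sum q (s * a) (s * b) (s * c) (s * d) (s * z) n"
  unfolding aw_raise_def aw_sum_def sum_distrib_left
proof (intro sum.cong refl)
  fix k assume "k \<in> {0..n}"
  then obtain m where n: "n = k + m"
    using le_Suc_ex by auto
  have q: "q = s * s"
    using assms(1) by (simp add: power2_eq_square)
  have 1: "s * a * (s * z) = a * z * q" "s * b * (s * z) = b * z * q" "s * a * (s * b) = a * b * q"
    "s * c * (s * d) = c * d * q" "s * c * (1 / (s * z)) = c / z" "s * d * (1 / (s * z)) = d / z"
    using assms(2,3) by (simp_all add: q)
  have 2: "q ^ m = s ^ m * s ^ m"
    by (simp add: q power_mult_distrib)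
  show "qbinom q n k * (q ^ (n - k) * (qpoch (a * z * q) q k * qpoch (b * z * q) q k / (qpoch (a * b * q) q k * z ^ k)) *
          (qpoch (c / z) q (n - k) * qpoch (d / z) q (n - k) * z ^ (n - k) / qpoch (c * d * q) q (n - k))) =
        s ^ n * (qbinom q n k * (aw_half q (s * a) (s * b) (s * z) k * aw_half q (s * c) (s * d) (1 / (s * z)) (n - k)))"
    using assms(2,3) unfolding aw_half_def 1
    by (simp add: n 2 power_add power_mult_distrib power_divide mult_ac)
qed

text \<open>The factor \<open>0 ^ (n - k)\<close> leaves only the summand \<open>k = n\<close>,
  where \<open>0 ^ 0 = 1\<close>.\<close>

lemma aw_raise_q_0:
  "aw_raise 0 a b c d z n = 1 / z ^ n"
proof -
  have 0: "norm (0 :: complex) < 1"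
    by simp
  have "aw_raise 0 a b c d z n = (\<Sum>k\<in>{n}. qbinom 0 n k * (0 ^ (n - k)
        * (qpoch (a * z * 0) 0 k * qpoch (b * z * 0) 0 k / (qpoch (a * b * 0) 0 k * z ^ k))
        * (qpoch (c / z) 0 (n - k) * qpoch (d / z) 0 (n - k) * z ^ (n - k) / qpoch (c * d * 0) 0 (n - k))))"
    unfolding aw_raise_def by (intro sum.mono_neutral_right) auto
  then show ?thesis
    using qbinom_self[OF 0] by (simp add: qpoch_def)
qed

text \<open>By \<open>aw_sum_eq_b_Q_Q\<close> the sum depends on \<open>z\<close> only through
  \<open>z + 1 / z\<close>.\<close>

lemma aw_sum_inverse:
  assumes "norm q < 1" "norm (a * b) < 1" "norm (c * d) < 1" "z \<noteq> 0"
  shows "aw_sum q a b c d (1 / z) n = aw_sum q a b c d z n"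
  using aw_sum_eq_b_Q_Q[OF assms(1-3), of z "(z + 1 / z) / 2" n]
    aw_sum_eq_b_Q_Q[OF assms(1-3), of "1 / z" "(z + 1 / z) / 2" n] assms(4)
  by (simp add: add.commute)

text \<open>The crucial identity is
  \<open>q\<^sup>m (1 - c z) (1 - d z) = (z - c q\<^sup>m) (z - d q\<^sup>m) + (q\<^sup>m - z\<^sup>2) (1 - c d q\<^sup>m)\<close>.\<close>

lemma aw_raise_term:
  assumes "norm q < 1" "norm (a * b) < 1" "norm (c * d) < 1" "z \<noteq> 0"
  shows "aw_factor a b c d z * (q ^ m
        * (qpoch (a * z * q) q k * qpoch (b * z * q) q k / (qpoch (a * b * q) q k * z ^ k))
        * (qpoch (c / z) q m * qpoch (d / z) q m * z ^ m / qpoch (c * d * q) q m)) =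
     (1 - a * b) * (1 - c * d) * (aw_half q a b z (Suc k) *
       (aw_half q c d (1 / z) (Suc m) + (q ^ m / z - z) * aw_half q c d (1 / z) m))"
proof -
  define X where "X = qpoch (a * z * q) q k * qpoch (b * z * q) q k"
  define Y where "Y = qpoch (c / z) q m * qpoch (d / z) q m"
  define Z where "Z = z ^ m"
  define V where "V = z ^ k"
  define K where "K = qpoch (a * b * q) q k"
  define L where "L = qpoch (c * d) q m"
  define r where "r = q ^ m"
  have nz: "1 - a * b \<noteq> 0" "1 - c * d \<noteq> 0" "1 - c * d * r \<noteq> 0" "L \<noteq> 0" "K \<noteq> 0" "z \<noteq> 0" "V \<noteq> 0" "Z \<noteq> 0"
    using assms qpoch_nonzero[OF assms(1,3)] qpoch_nonzero[OF assms(1) norm_mult_less_1[OF assms(2,1)]]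
      one_minus_mult_power_neq_0[OF assms(1,3), of m]
    by (auto simp: r_def K_def L_def V_def Z_def)
  have s: "qpoch (c * d * q) q m = L * (1 - c * d * r) / (1 - c * d)"
    using nz by (simp add: qpoch_shift_eq qpoch_Suc r_def L_def)
  have h1: "aw_half q a b z (Suc k) = (1 - a * z) * (1 - b * z) * X / ((1 - a * b) * K * (z * V))"
    by (simp add: aw_half_def qpoch_Suc_shift X_def K_def V_def mult_ac)
  have h2: "aw_half q c d (1 / z) m = Y * Z / L"
    by (simp add: aw_half_def Y_def Z_def L_def power_divide)
  have h3: "aw_half q c d (1 / z) (Suc m) = Y * Z * ((1 - c / z * r) * (1 - d / z * r) * z) / (L * (1 - c * d * r))"
    by (simp add: aw_half_def Y_def Z_def L_def power_divide qpoch_Suc r_def mult_ac)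
  have e: "(1 - c / z * r) * (1 - d / z * r) * z / (1 - c * d * r) + (r / z - z) =
        r * ((1 - c * z) * (1 - d * z)) / (z * (1 - c * d * r))"
    using nz by (simp add: divide_simps) (simp add: algebra_simps power2_eq_square)
  have "aw_half q c d (1 / z) (Suc m) + (r / z - z) * aw_half q c d (1 / z) m =
      Y * Z / L * ((1 - c / z * r) * (1 - d / z * r) * z / (1 - c * d * r) + (r / z - z))"
    unfolding h2 h3 using nz by (simp add: field_simps)
  also have "\<dots> = Y * Z / L * (r * ((1 - c * z) * (1 - d * z)) / (z * (1 - c * d * r)))"
    by (simp only: e)
  finally have h: "aw_half q c d (1 / z) (Suc m) + (r / z - z) * aw_half q c d (1 / z) m =
      Y * Z / L * (r * ((1 - c * z) * (1 - d * z)) / (z * (1 - c * d * r)))" .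
  show ?thesis
    unfolding r_def[symmetric] h h1 unfolding aw_factor_def s X_def[symmetric] Y_def[symmetric]
      K_def[symmetric] Z_def[symmetric] V_def[symmetric]
    using nz by (simp add: power2_eq_square mult_ac)
qed

text \<open>\<open>aw_raise_term\<close> is applied once as it stands and once with the pairs of
  parameters exchanged and \<open>z\<close> inverted. In the difference the products with both
  indices raised cancel, and the rest is \<open>1 / z\<close> times the first q-Pascal sum minus
  \<open>z\<close> times the second.\<close>

lemma aw_raising:
  assumes "norm q < 1" "norm (a * b) < 1" "norm (c * d) < 1" "z \<noteq> 0"
  shows "(1 - a * b) * (1 - c * d) * ((1 / z - z) * aw_sum q a b c d z (Suc n)) =
           aw_factor a b c d z * aw_raise q a b c d z n
           - aw_factor c d a b (1 / z) * aw_raise q c d a b (1 / z) n"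
proof -
  define x where "x = aw_half q a b z"
  define y where "y = aw_half q c d (1 / z)"
  define F where "F k = x k * y (Suc n - k)" for k
  let ?K = "(1 - a * b) * (1 - c * d)"
  have 1: "aw_factor a b c d z * aw_raise q a b c d z n =
      (\<Sum>k=0..n. ?K * (qbinom q n k * (x (Suc k) * (y (Suc n - k) + (q ^ (n - k) / z - z) * y (n - k)))))"
    unfolding aw_raise_def sum_distrib_left
  proof (intro sum.cong refl)
    fix k assume "k \<in> {0..n}"
    then have "Suc n - k = Suc (n - k)"
      by auto
    then show "aw_factor a b c d z * (qbinom q n k * (q ^ (n - k)
        * (qpoch (a * z * q) q k * qpoch (b * z * q) q k / (qpoch (a * b * q) q k * z ^ k))
        * (qpoch (c / z) q (n - k) * qpoch (d / z) q (n - k) * z ^ (n - k) / qpoch (c * d * q) q (n - k)))) =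
        ?K * (qbinom q n k * (x (Suc k) * (y (Suc n - k) + (q ^ (n - k) / z - z) * y (n - k))))"
      using arg_cong[OF aw_raise_term[OF assms, of "n - k" k], of "(*) (qbinom q n k)"] unfolding x_def y_def
      by (simp only: mult.left_commute[of "qbinom q n k"])
  qed
  have 2: "aw_factor c d a b (1 / z) * aw_raise q c d a b (1 / z) n =
      (\<Sum>k=0..n. ?K * (qbinom q n k * (y (Suc n - k) * (x (Suc k) + (q ^ k * z - 1 / z) * x k))))"
    unfolding aw_raise_def sum_distrib_left
  \<comment> \<open>Reversing the order of summation matches the index of the exchanged pair with
    that of the first sum.\<close>
  proof (subst sum.atLeastAtMost_rev, intro sum.cong refl)
    fix k assume k: "k \<in> {0..n}"
    have z: "1 / z \<noteq> 0" "1 / (1 / z) = z" "w / (1 / z) = w * z" for w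
      using assms by auto
    have k': "n + 0 - k = n - k" "n - (n - k) = k" "Suc n - k = Suc (n - k)" "qbinom q n (n - k) = qbinom q n k"
      using k by (auto simp: qbinom_sym)
    show "aw_factor c d a b (1 / z) * (qbinom q n (n + 0 - k) * (q ^ (n - (n + 0 - k))
        * (qpoch (c * (1 / z) * q) q (n + 0 - k) * qpoch (d * (1 / z) * q) q (n + 0 - k) / (qpoch (c * d * q) q (n + 0 - k) * (1 / z) ^ (n + 0 - k)))
        * (qpoch (a / (1 / z)) q (n - (n + 0 - k)) * qpoch (b / (1 / z)) q (n - (n + 0 - k)) * (1 / z) ^ (n - (n + 0 - k)) / qpoch (a * b * q) q (n - (n + 0 - k))))) =
        ?K * (qbinom q n k * (y (Suc n - k) * (x (Suc k) + (q ^ k * z - 1 / z) * x k)))"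
      unfolding k'
      using arg_cong[OF aw_raise_term[OF assms(1) assms(3) assms(2) z(1), of k "n - k"], of "(*) (qbinom q n k)"]
      unfolding x_def y_def z
      by (simp only: mult.left_commute[of "qbinom q n k"] mult.commute[of "1 - c * d"] mult_1)
  qed
  \<comment> \<open>The common term \<open>x (Suc k) * y (Suc n - k)\<close> cancels; what is left
    is \<open>F (Suc k)\<close> and \<open>F k\<close> with the weights of the two q-Pascal
    rules.\<close>
  have "aw_factor a b c d z * aw_raise q a b c d z n - aw_factor c d a b (1 / z) * aw_raise q c d a b (1 / z) n =
      (\<Sum>k=0..n. ?K * (1 / z * (qbinom q n k * (q ^ (n - k) * F (Suc k) + F k))
                       - z * (qbinom q n k * (F (Suc k) + q ^ k * F k))))"
    unfolding 1 2 sum_subtractf[symmetric]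
    by (intro sum.cong refl) (simp add: F_def algebra_simps)
  also have "\<dots> = ?K * (1 / z * (\<Sum>k=0..n. qbinom q n k * (q ^ (n - k) * F (Suc k) + F k))
                       - z * (\<Sum>k=0..n. qbinom q n k * (F (Suc k) + q ^ k * F k)))"
    by (simp only: sum_distrib_left sum_subtractf right_diff_distrib)
  also have "\<dots> = ?K * (1 / z * aw_sum q a b c d z (Suc n) - z * aw_sum q a b c d z (Suc n))"
    unfolding sum_qbinom_Suc[OF assms(1), symmetric] by (simp only: aw_sum_def F_def x_def y_def)
  finally show ?thesis
    by (simp add: algebra_simps)
qed

section \<open>The sums as polynomials\<close>

lemma asc_Q_poly: "\<exists>p. (\<forall>x. poly p x = asc_Q n x a b q) \<and> degree p \<le> n \<and> coeff p n = 2 ^ n"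
proof (induction n rule: induct_nat_012)
  case 1
  show ?case
    by (intro exI[of _ "[:-(a + b), 2:]"]) auto
next
  case (ge2 n)
  then obtain p r where p: "\<And>x. poly p x = asc_Q n x a b q" "degree p \<le> n" "coeff p n = 2 ^ n"
    and r: "\<And>x. poly r x = asc_Q (Suc n) x a b q" "degree r \<le> Suc n" "coeff r (Suc n) = 2 ^ Suc n"
    by blast
  show ?case
    using p r
    by (intro exI[of _ "[:-(a + b) * q ^ Suc n, 2:] * r - smult ((1 - a * b * q ^ n) * (1 - q ^ Suc n)) p"])
       (auto simp: algebra_simps coeff_eq_0 intro!: degree_diff_le degree_add_le order.trans[OF degree_smult_le]
         order.trans[OF degree_pCons_le])
qed (auto intro!: exI[of _ 1])

text \<open>Only a degree bound is possible: the coefficient at \<open>n\<close> can vanish, for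
  instance when \<open>a * b = 0\<close>.\<close>

lemma asc_dual_poly: "\<exists>p. (\<forall>x. poly p x = asc_dual n x a b q) \<and> degree p \<le> n \<and>
    coeff p n = (- 2 * (a * b)) ^ n * q ^ (n choose 2)"
proof (induction n rule: induct_nat_012)
  case 0
  show ?case
    by (intro exI[of _ 1]) (auto simp: numeral_2_eq_2)
next
  case 1
  show ?case
    by (intro exI[of _ "[:a + b, - 2 * (a * b):]"]) (auto simp: numeral_2_eq_2)
next
  case (ge2 n)
  then obtain p r where p: "\<And>x. poly p x = asc_dual n x a b q" "degree p \<le> n"
    and r: "\<And>x. poly r x = asc_dual (Suc n) x a b q" "degree r \<le> Suc n"
      "coeff r (Suc n) = (- 2 * (a * b)) ^ Suc n * q ^ (Suc n choose 2)"
    by blast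
  show ?case
    using p r
    by (intro exI[of _ "[:a + b, - 2 * (a * b) * q ^ Suc n:] * r
          - smult ((1 - a * b * q ^ n) * (1 - q ^ Suc n) * (a * b)) p"])
       (auto simp: algebra_simps coeff_eq_0 choose_two_Suc power_add intro!: degree_diff_le degree_add_le order.trans[OF degree_smult_le]
         order.trans[OF degree_pCons_le])
qed

lemma coeff_mult_top:
  assumes "degree p \<le> m" "degree r \<le> n"
  shows "coeff (p * r) (m + n) = coeff p m * coeff r n"
proof (cases "degree p = m \<and> degree r = n")
  case True
  then show ?thesis
    using coeff_mult_degree_sum[of p r] by auto
next
  case False
  then have "degree p < m \<or> degree r < n"
    using assms by linarith
  moreover have "degree (p * r) < m + n"
    using calculation assms degree_mult_le[of p r] by linarith
  ultimately show ?thesis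
    by (auto simp: coeff_eq_0)
qed

text \<open>In \<open>aw_sum_eq_Q_dual\<close> every summand is a polynomial in \<open>x\<close> of
  degree at most \<open>n\<close>, and the coefficients at \<open>n\<close> add up to the left side
  of \<open>q_Vandermonde\<close>.\<close>

lemma aw_sum_poly:
  assumes "norm q < 1" "norm (a * b) < 1" "norm (c * d) < 1"
  shows "\<exists>p. (\<forall>z. z \<noteq> 0 \<longrightarrow> poly p ((z + 1 / z) / 2) = aw_sum q a b c d z n) \<and> degree p \<le> n \<and>
    coeff p n = 2 ^ n * (qpoch (a * b * c * d * q ^ (n - 1)) q n / (qpoch (a * b) q n * qpoch (c * d) q n))"
proof -
  obtain Q where Q: "\<And>n x. poly (Q n) x = asc_Q n x c d q" "\<And>n. degree (Q n) \<le> n" "\<And>n. coeff (Q n) n = 2 ^ n"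
    using asc_Q_poly[of _ c d q] by metis
  obtain T where T: "\<And>n x. poly (T n) x = asc_dual n x a b q" "\<And>n. degree (T n) \<le> n"
    "\<And>n. coeff (T n) n = (- 2 * (a * b)) ^ n * q ^ (n choose 2)"
    using asc_dual_poly[of _ a b q] by metis
  define \<alpha> where "\<alpha> m = qbinom q n m * ((-1) ^ m * q ^ (m choose 2)) / (qpoch (a * b) q m * qpoch (c * d) q (n - m))" for m
  define p where "p = (\<Sum>m=0..n. smult (\<alpha> m) (T m * Q (n - m)))"
  have "poly p ((z + 1 / z) / 2) = aw_sum q a b c d z n" if "z \<noteq> 0" for z
    unfolding aw_sum_eq_Q_dual[OF assms that, of "(z + 1 / z) / 2" n, symmetric, simplified]
    by (simp add: p_def poly_sum T Q \<alpha>_def mult_ac)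
  moreover have deg: "degree (T m * Q (n - m)) \<le> n" if "m \<le> n" for m
    using order.trans[OF degree_mult_le add_mono[OF T(2) Q(2)], of m "n - m"] that by simp
  then have "degree p \<le> n"
    unfolding p_def by (intro degree_sum_le) (auto intro: order.trans[OF degree_smult_le])
  moreover have "coeff p n = 2 ^ n * (qpoch (a * b * c * d * q ^ (n - 1)) q n / (qpoch (a * b) q n * qpoch (c * d) q n))"
  proof -
    have c: "coeff (T m * Q (n - m)) n = 2 ^ n * ((- 1) ^ m * (a * b) ^ m * q ^ (m choose 2))" if "m \<le> n" for m
    proof -
      have "coeff (T m * Q (n - m)) (m + (n - m)) = coeff (T m) m * coeff (Q (n - m)) (n - m)"
        by (rule coeff_mult_top[OF T(2) Q(2)])
      then show ?thesis
        using that power_add[of "2::complex" m "n - m"]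
        by (simp add: T(3) Q(3) power_mult_distrib power_minus[of "2 * _"] power_minus[of "a * _"] power_minus[of 2])
    qed
    \<comment> \<open>The explicit sign and power of \<open>q\<close> meet those of the coefficient
      of \<open>T m\<close>: the signs cancel, and twice \<open>m choose 2\<close> is
      \<open>m * (m - 1)\<close>.\<close>
    have e: "(-1) ^ m * q ^ (m choose 2) * ((- 1) ^ m * (a * b) ^ m * q ^ (m choose 2)) =
        (a * b) ^ m * q ^ (m * (m - 1))" for m
    proof -
      have "(m choose 2) + (m choose 2) = m * (m - 1)"
        by (induction m) (auto simp: choose_two_Suc numeral_2_eq_2 algebra_simps)
      then show ?thesis
        by (simp add: mult_ac flip: power_add power_mult_distrib)
    qed
    have "\<alpha> m * coeff (T m * Q (n - m)) n = 2 ^ n * (qbinom q n m *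
        ((a * b) ^ m * q ^ (m * (m - 1)) / (qpoch (a * b) q m * qpoch (c * d) q (n - m))))" if "m \<le> n" for m
      unfolding \<alpha>_def c[OF that] e[symmetric] by (simp only: mult_ac times_divide_eq_left times_divide_eq_right)
    then have "coeff p n = 2 ^ n * (\<Sum>m=0..n. qbinom q n m *
        ((a * b) ^ m * q ^ (m * (m - 1)) / (qpoch (a * b) q m * qpoch (c * d) q (n - m))))"
      unfolding p_def coeff_sum sum_distrib_left by (intro sum.cong) auto
    then show ?thesis
      unfolding q_Vandermonde[OF assms] by (simp add: mult_ac)
  qed
  ultimately show ?thesis
    by blast
qed

section \<open>The infinite \<open>q\<close>-Pochhammer symbol\<close>

lemma convergent_qpoch_inf:
  fixes q z :: complex
  assumes "norm q < 1"
  shows "convergent_prod (\<lambda>i. 1 - z * q ^ i)"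
proof -
  have "summable (\<lambda>i. norm z * norm q ^ i)"
    using assms by (intro summable_mult summable_geometric) simp
  then have "summable (\<lambda>i. norm ((1 - z * q ^ i) - 1))"
    by (simp add: norm_mult norm_power)
  then show ?thesis
    by (intro abs_convergent_prod_imp_convergent_prod summable_imp_abs_convergent_prod)
qed

lemma qpoch_tendsto:
  assumes "norm q < 1"
  shows "(\<lambda>n. qpoch z q n) \<longlonglongrightarrow> qpoch_inf z q"
proof -
  have "(\<lambda>n. \<Prod>i\<le>n. 1 - z * q ^ i) \<longlonglongrightarrow> qpoch_inf z q"
    unfolding qpoch_inf_def using convergent_qpoch_inf[OF assms] by (rule convergent_prod_LIMSEQ)
  then have "(\<lambda>n. qpoch z q (Suc n)) \<longlonglongrightarrow> qpoch_inf z q"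
    by (simp add: qpoch_def lessThan_Suc_atMost)
  then show ?thesis
    by (rule LIMSEQ_imp_Suc)
qed

lemma qpoch_inf_Suc:
  assumes "norm q < 1"
  shows "qpoch_inf z q = (1 - z) * qpoch_inf (z * q) q"
proof (rule LIMSEQ_unique)
  show "(\<lambda>n. qpoch z q (Suc n)) \<longlonglongrightarrow> qpoch_inf z q"
    using qpoch_tendsto[OF assms] by (rule LIMSEQ_Suc)
  show "(\<lambda>n. qpoch z q (Suc n)) \<longlonglongrightarrow> (1 - z) * qpoch_inf (z * q) q"
    unfolding qpoch_Suc_shift by (intro tendsto_mult_left qpoch_tendsto assms)
qed

lemma qpoch_inf_nonzero:
  assumes "norm q < 1" "norm z < 1"
  shows "qpoch_inf z q \<noteq> 0"
  unfolding qpoch_inf_def using convergent_qpoch_inf[OF assms(1)] one_minus_mult_power_neq_0[OF assms]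
  by (rule prodinf_nonzero)

text \<open>On the unit circle only the factor \<open>1 - z\<close> can vanish; the remaining
  product has argument \<open>z * q\<close> inside the disc.\<close>

lemma qpoch_inf_nonzero':
  assumes "norm q < 1" "norm z = 1" "z \<noteq> 1"
  shows "qpoch_inf z q \<noteq> 0"
  using assms qpoch_inf_nonzero[of q "z * q"] qpoch_inf_Suc[of q z] by (simp add: norm_mult)

lemma qpoch_inf_0_left [simp]: "qpoch_inf 0 q = 1"
  by (simp add: qpoch_inf_def)

lemma qpoch_inf_0_right: "qpoch_inf z 0 = 1 - z"
  using qpoch_inf_Suc[of 0 z] by simp

lemma qpoch_inf_cnj:
  assumes "norm q < 1"
  shows "cnj (qpoch_inf z q) = qpoch_inf (cnj z) (cnj q)"
proof (rule LIMSEQ_unique)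
  show "(\<lambda>n. cnj (qpoch z q n)) \<longlonglongrightarrow> cnj (qpoch_inf z q)"
    by (intro tendsto_cnj qpoch_tendsto assms)
  show "(\<lambda>n. cnj (qpoch z q n)) \<longlonglongrightarrow> qpoch_inf (cnj z) (cnj q)"
    using qpoch_tendsto[of "cnj q" "cnj z"] assms by (simp add: qpoch_def)
qed

text \<open>The partial products converge uniformly on every closed ball of radius 1, by a geometric
  majorant for \<open>norm (z * q ^ n)\<close>.\<close>

lemma holomorphic_qpoch_inf:
  assumes "norm q < 1"
  shows "(\<lambda>z. qpoch_inf z q) holomorphic_on UNIV"
proof (rule holomorphic_uniform_sequence[where f = "\<lambda>n z. qpoch z q n"])
  show "(\<lambda>z. qpoch z q n) holomorphic_on UNIV" for n
    unfolding qpoch_def by (intro holomorphic_intros)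
  show "\<exists>d>0. cball x d \<subseteq> UNIV \<and> uniform_limit (cball x d) (\<lambda>n z. qpoch z q n) (\<lambda>z. qpoch_inf z q) sequentially" for x
  proof (intro exI[of _ 1] conjI)
    have "uniformly_convergent_on (cball x 1) (\<lambda>N z. \<Sum>n<N. norm (1 - z * q ^ n - 1))"
    proof (rule Weierstrass_m_test')
      show "norm (norm (1 - z * q ^ n - 1)) \<le> (norm x + 1) * norm q ^ n" if "z \<in> cball x 1" for n z
      proof -
        have "norm z \<le> norm x + 1"
          using that norm_triangle_sub[of z x] by (simp add: dist_norm norm_minus_commute)
        then show ?thesis
          by (simp add: norm_mult norm_power mult_right_mono)
      qed
      show "summable (\<lambda>n. (norm x + 1) * norm q ^ n)"
        using assms by (intro summable_mult summable_geometric) simp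
    qed
    then have "uniformly_convergent_on (cball x 1) (\<lambda>N z. \<Prod>n<N. 1 - z * q ^ n)"
      by (intro uniformly_convergent_on_prod') (auto intro!: continuous_intros)
    then obtain l where l: "uniform_limit (cball x 1) (\<lambda>n z. qpoch z q n) l sequentially"
      by (auto simp: uniformly_convergent_on_def qpoch_def)
    moreover have "l z = qpoch_inf z q" if "z \<in> cball x 1" for z
      using tendsto_uniform_limitI[OF l that] qpoch_tendsto[OF assms] by (rule LIMSEQ_unique)
    ultimately show "uniform_limit (cball x 1) (\<lambda>n z. qpoch z q n) (\<lambda>z. qpoch_inf z q) sequentially"
      using uniform_limit_cong'[of "cball x 1" "\<lambda>n z. qpoch z q n" "\<lambda>n z. qpoch z q n" l "\<lambda>z. qpoch_inf z q" sequentially]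
      by auto
  qed auto
qed auto

lemma holomorphic_on_qpoch_inf [holomorphic_intros]:
  assumes "norm q < 1" "f holomorphic_on S"
  shows "(\<lambda>z. qpoch_inf (f z) q) holomorphic_on S"
  using holomorphic_on_compose_gen[OF assms(2) holomorphic_qpoch_inf[OF assms(1)]] by (simp add: o_def)

lemma continuous_on_qpoch_inf [continuous_intros]:
  assumes "norm q < 1" "continuous_on S f"
  shows "continuous_on S (\<lambda>z. qpoch_inf (f z) q)"
  using continuous_on_compose2[OF holomorphic_on_imp_continuous_on[OF holomorphic_qpoch_inf[OF assms(1)]] assms(2)]
  by auto

section \<open>Integrals over the unit circle\<close>

text \<open>Integration is with respect to arc length, that is, the contour integral of
  \<open>f z / (\<i> * z)\<close>; this makes it invariant under \<open>z\<close> to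
  \<open>1 / z\<close> and under changes of radius in an annulus of analyticity.\<close>

definition circle_int :: "(complex \<Rightarrow> complex) \<Rightarrow> complex" where
  "circle_int f = integral {-pi..pi} (\<lambda>t. f (cis t))"

lemma integrable_circle:
  fixes f :: "complex \<Rightarrow> complex" and a b :: real
  assumes "continuous_on (sphere 0 1) f"
  shows "(\<lambda>t. f (cis t)) integrable_on {a..b}"
  by (intro integrable_continuous_interval continuous_on_compose2[OF assms]) (auto intro!: continuous_intros)

lemma circle_int_add:
  assumes "continuous_on (sphere 0 1) f" "continuous_on (sphere 0 1) g"
  shows "circle_int (\<lambda>z. f z + g z) = circle_int f + circle_int g"
  unfolding circle_int_def using assms by (intro integral_add integrable_circle)

lemma circle_int_cmult: "circle_int (\<lambda>z. c * f z) = c * circle_int f"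
  by (simp add: circle_int_def)

lemma circle_int_cong:
  assumes "\<And>z. norm z = 1 \<Longrightarrow> f z = g z"
  shows "circle_int f = circle_int g"
  unfolding circle_int_def by (intro integral_cong) (simp add: assms)

text \<open>The points 1 and -1 are exempt because the raising relation has to be divided by
  \<open>1 / z - z\<close>.\<close>

lemma circle_int_spike:
  assumes "\<And>z. norm z = 1 \<Longrightarrow> z \<noteq> 1 \<Longrightarrow> z \<noteq> -1 \<Longrightarrow> f z = g z"
  shows "circle_int f = circle_int g"
  unfolding circle_int_def
proof (rule integral_spike)
  show "negligible {-pi, 0, pi}"
    by (intro negligible_finite) auto
  fix t assume t: "t \<in> {-pi..pi} - {-pi, 0, pi}"
  have "sin t \<noteq> 0"
    using t sin_gt_zero[of t] sin_gt_zero[of "-t"] by (cases "t > 0") auto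
  then show "g (cis t) = f (cis t)"
    by (intro assms[symmetric]) (auto simp: complex_eq_iff)
qed

lemma circle_int_inverse: "circle_int (\<lambda>z. f (1 / z)) = circle_int f"
proof -
  have "circle_int (\<lambda>z. f (1 / z)) = integral {-pi..pi} (\<lambda>t. f (cis (- t)))"
    by (simp add: circle_int_def inverse_eq_divide[symmetric] cis_inverse)
  also have "\<dots> = circle_int f"
    using Henstock_Kurzweil_Integration.integral_reflect_real[of pi "-pi" "\<lambda>t. f (cis t)"] by (simp add: circle_int_def)
  finally show ?thesis .
qed

lemma integral_0_pi_eq_circle_int:
  assumes "continuous_on (sphere 0 1) f" "\<And>z. norm z = 1 \<Longrightarrow> f (1 / z) = f z"
  shows "integral {0..pi} (\<lambda>t. f (cis t)) = circle_int f / 2"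
proof -
  have "integral {-pi..-0} (\<lambda>t. f (cis (- t))) = integral {0..pi} (\<lambda>t. f (cis t))"
    by (rule Henstock_Kurzweil_Integration.integral_reflect_real)
  moreover have "f (cis (- t)) = f (cis t)" for t
    using assms(2)[of "cis t"] by (simp add: inverse_eq_divide[symmetric] cis_inverse)
  moreover have "integral {-pi..0} (\<lambda>t. f (cis t)) + integral {0..pi} (\<lambda>t. f (cis t)) = circle_int f"
    unfolding circle_int_def using integrable_circle[OF assms(1)] by (intro Henstock_Kurzweil_Integration.integral_combine) auto
  ultimately show ?thesis
    by (simp add: mult.commute)
qed

text \<open>Cauchy's theorem: along the circle \<open>dz = \<i> * z dt\<close>, so up to the factor
  \<open>\<i>\<close> the integrand is the derivative of a primitive of \<open>F\<close>.\<close>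

lemma circle_int_disc:
  assumes "F holomorphic_on ball 0 r" "r > 1"
  shows "circle_int (\<lambda>z. z * F z) = 0"
proof -
  obtain G where G: "\<And>z. z \<in> ball 0 r \<Longrightarrow> (G has_field_derivative F z) (at z within ball 0 r)"
    using holomorphic_convex_primitive'[OF convex_ball open_ball assms(1)] by metis
  have "((\<lambda>t. \<i> * (cis t * F (cis t))) has_integral (G (cis pi) - G (cis (- pi)))) {-pi..pi}"
  proof (rule fundamental_theorem_of_calculus)
    fix t assume "t \<in> {-pi..pi}"
    have "(G has_field_derivative F (cis t)) (at (cis t))"
      using G[of "cis t"] assms(2) at_within_open[of "cis t" "ball 0 r"] by auto
    moreover have "(cis has_vector_derivative \<i> * cis t) (at t within {-pi..pi})"
      unfolding has_vector_derivative_def by (rule has_derivative_cis has_derivative_ident)+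
    ultimately show "((\<lambda>t. G (cis t)) has_vector_derivative \<i> * (cis t * F (cis t))) (at t within {-pi..pi})"
      using field_vector_diff_chain_within[of cis "\<i> * cis t" t "{-pi..pi}" G "F (cis t)"]
      by (simp add: o_def has_field_derivative_at_within mult.assoc mult.commute[of "F _"])
  qed simp
  moreover have "cis (- pi) = cis pi"
    by (simp add: complex_eq_iff)
  ultimately have "circle_int (\<lambda>z. \<i> * (z * F z)) = 0"
    by (simp add: circle_int_def integral_unique del: integral_mult_right)
  then show ?thesis
    by (simp add: circle_int_cmult)
qed

text \<open>Independence of the radius. The exponential map pulls the annulus back to a vertical
  strip, which is convex, so \<open>F\<close> composed with \<open>exp\<close> has a primitive
  there; its increment over the period \<open>2 * pi * \<i>\<close> is constant.\<close>

lemma circle_int_dilate: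
  assumes F: "F holomorphic_on {w. r1 < norm w \<and> norm w < r2}"
    and r: "0 < r1" "r1 < 1" "1 < r2" "r1 < norm s" "norm s < r2"
  shows "circle_int (\<lambda>z. F (s * z)) = circle_int F"
proof -
  define S where "S = {w. Re w > ln r1} \<inter> {w. Re w < ln r2}"
  have S: "convex S" "open S"
    unfolding S_def
    by (auto intro!: convex_Int convex_halfspace_Re_gt convex_halfspace_Re_lt open_Int open_halfspace_Re_gt open_halfspace_Re_lt)
  have "exp w \<in> {w. r1 < norm w \<and> norm w < r2}" if "w \<in> S" for w
    using that r exp_less_mono[of "ln r1" "Re w"] exp_less_mono[of "Re w" "ln r2"] by (simp add: S_def)
  then have "exp ` S \<subseteq> {w. r1 < norm w \<and> norm w < r2}"
    by blast
  from holomorphic_on_compose_gen[OF holomorphic_on_exp F this]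
  have hol: "(\<lambda>w. F (exp w)) holomorphic_on S"
    by (simp only: o_def)
  obtain G where G: "\<And>w. w \<in> S \<Longrightarrow> (G has_field_derivative F (exp w)) (at w within S)"
    using holomorphic_convex_primitive'[OF S hol] by blast
  have G': "(G has_field_derivative F (exp w)) (at w)" if "w \<in> S" for w
    using G[OF that] at_within_open[OF that S(2)] by simp
  \<comment> \<open>The increment has derivative 0 because \<open>exp\<close> has period
    \<open>2 * pi * \<i>\<close>.\<close>
  define D where "D w = G (w + 2 * pi * \<i>) - G w" for w
  have "(D has_field_derivative 0) (at w within S)" if "w \<in> S" for w
  proof -
    have "w + 2 * pi * \<i> \<in> S"
      using that by (simp add: S_def)
    from G'[OF this] have "((\<lambda>w. G (w + 2 * pi * \<i>)) has_field_derivative F (exp w)) (at w)"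
      using DERIV_shift[of G "F (exp w)" w "2 * pi * \<i>"] by (simp add: exp_add)
    from DERIV_diff[OF this G'[OF that]]
    have "(D has_field_derivative 0) (at w)"
      unfolding D_def by simp
    then show ?thesis
      by (rule has_field_derivative_at_within)
  qed
  then obtain c where c: "\<And>w. w \<in> S \<Longrightarrow> D w = c"
    using has_field_derivative_zero_constant[OF S(1), of D] by auto
  \<comment> \<open>The circle through \<open>exp l\<close> lifts to the vertical segment from
    \<open>l - \<i> * pi\<close> to \<open>l + \<i> * pi\<close>, over which the primitive grows by
    \<open>c\<close>.\<close>
  have *: "circle_int (\<lambda>z. F (exp l * z)) = c / \<i>" if "l \<in> S" for l
  proof -
    have "((\<lambda>t. \<i> * F (exp l * cis t)) has_integral (G (l + \<i> * pi) - G (l + \<i> * (- pi)))) {-pi..pi}"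
      unfolding of_real_minus[symmetric]
    proof (rule fundamental_theorem_of_calculus)
      fix t assume "t \<in> {-pi..pi}"
      have "(G has_field_derivative F (exp (l + \<i> * t))) (at (l + \<i> * t))"
        using that by (intro G') (simp add: S_def)
      moreover have "((\<lambda>t. l + \<i> * of_real t) has_vector_derivative \<i>) (at t within {-pi..pi})"
        unfolding has_vector_derivative_def scaleR_conv_of_real
        by (auto intro!: derivative_eq_intros)
      ultimately have "((\<lambda>t. G (l + \<i> * of_real t)) has_vector_derivative \<i> * F (exp (l + \<i> * t))) (at t within {-pi..pi})"
        using field_vector_diff_chain_within[of "\<lambda>t. l + \<i> * of_real t" \<i> t "{-pi..pi}" G "F (exp (l + \<i> * t))"]
        by (simp add: o_def has_field_derivative_at_within)
      then show "((\<lambda>t. G (l + \<i> * of_real t)) has_vector_derivative \<i> * F (exp l * cis t)) (at t within {-pi..pi})"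
        by (simp only: exp_add cis_conv_exp)
    qed simp
    moreover have "G (l + \<i> * pi) - G (l + \<i> * (- pi)) = D (l - \<i> * pi)"
      by (simp add: D_def algebra_simps)
    moreover have "D (l - \<i> * pi) = c"
      using that by (intro c) (simp add: S_def)
    ultimately have "circle_int (\<lambda>z. \<i> * F (exp l * z)) = c"
      by (simp add: circle_int_def integral_unique del: integral_mult_right)
    then have "\<i> * circle_int (\<lambda>z. F (exp l * z)) = c"
      by (simp only: circle_int_cmult)
    then show ?thesis
      by auto
  qed
  have "s \<noteq> 0"
    using r by auto
  then have "exp (Ln s) = s" "Ln s \<in> S" "0 \<in> S"
    using r by (auto simp: S_def)
  then show ?thesis
    using *[of "Ln s"] *[of 0] by simp
qed

section \<open>Orthogonality\<close>

definition aw_pair :: "complex \<Rightarrow> complex \<Rightarrow> complex \<Rightarrow> complex" where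
  "aw_pair q h z = qpoch_inf (h * z) q * qpoch_inf (h / z) q"

definition aw_circ :: "complex \<Rightarrow> complex \<Rightarrow> complex \<Rightarrow> complex \<Rightarrow> complex \<Rightarrow> complex \<Rightarrow> complex" where
  "aw_circ q a b c d z = qpoch_inf (z\<^sup>2) q * qpoch_inf (1 / z\<^sup>2) q /
     (aw_pair q a z * aw_pair q b z * aw_pair q c z * aw_pair q d z)"

text \<open>The quotient of \<open>aw_circ\<close> by \<open>z - 1 / z\<close>, with the zeros of
  the divisor at 1 and -1 cancelled in advance.\<close>

definition aw_skew :: "complex \<Rightarrow> complex \<Rightarrow> complex \<Rightarrow> complex \<Rightarrow> complex \<Rightarrow> complex \<Rightarrow> complex" where
  "aw_skew q a b c d z = qpoch_inf (z\<^sup>2) q * qpoch_inf (q / z\<^sup>2) q /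
     (z * (aw_pair q a z * aw_pair q b z * aw_pair q c z * aw_pair q d z))"

lemma aw_pair_inverse [simp]: "aw_pair q h (1 / z) = aw_pair q h z"
  by (simp add: aw_pair_def)

lemma aw_circ_inverse [simp]: "aw_circ q a b c d (1 / z) = aw_circ q a b c d z"
  by (simp add: aw_circ_def power_divide)

lemma aw_circ_swap: "aw_circ q c d a b z = aw_circ q a b c d z"
  by (simp add: aw_circ_def mult_ac)

lemma aw_pair_nonzero:
  assumes "norm q < 1" "norm (h * z) < 1" "norm (h / z) < 1"
  shows "aw_pair q h z \<noteq> 0"
  using assms by (simp add: aw_pair_def qpoch_inf_nonzero)

lemma holomorphic_on_aw_pair [holomorphic_intros]:
  assumes "norm q < 1" "0 \<notin> S"
  shows "aw_pair q h holomorphic_on S"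
  unfolding aw_pair_def[abs_def] using assms by (intro holomorphic_intros) auto

lemma aw_circ_skew:
  assumes "norm q < 1" "z \<noteq> 0"
  shows "aw_circ q a b c d z = (z - 1 / z) * aw_skew q a b c d z"
proof -
  have "qpoch_inf (1 / z\<^sup>2) q = (1 - 1 / z\<^sup>2) * qpoch_inf (q / z\<^sup>2) q"
    using qpoch_inf_Suc[OF assms(1), of "1 / z\<^sup>2"] by simp
  moreover have "1 - 1 / z\<^sup>2 = (z - 1 / z) / z"
    using assms(2) by (simp add: field_simps power2_eq_square)
  ultimately show ?thesis
    by (simp add: aw_circ_def aw_skew_def)
qed

lemma qpoch_inf_1 [simp]: "norm q < 1 \<Longrightarrow> qpoch_inf 1 q = 0"
  using qpoch_inf_Suc[of q 1] by simp

lemma aw_skew_inverse: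
  assumes "norm q < 1" "z \<noteq> 0"
  shows "aw_skew q a b c d (1 / z) = - aw_skew q a b c d z"
\<comment> \<open>Here nothing can be cancelled, but both sides vanish since the numerator contains
  \<open>qpoch_inf 1 q = 0\<close>.\<close>
proof (cases "z\<^sup>2 = 1")
  case True
  then show ?thesis
    using assms by (simp add: aw_skew_def power_divide)
next
  case False
  then have "z - 1 / z \<noteq> 0"
    using assms by (simp add: field_simps power2_eq_square)
  moreover have "(z - 1 / z) * aw_skew q a b c d (1 / z) = (z - 1 / z) * (- aw_skew q a b c d z)"
  proof -
    have "(z - 1 / z) * aw_skew q a b c d (1 / z) = - ((1 / z - z) * aw_skew q a b c d (1 / z))"
      by (simp add: algebra_simps)
    also have "(1 / z - z) * aw_skew q a b c d (1 / z) = aw_circ q a b c d z"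
      using aw_circ_skew[of q "1 / z" a b c d] assms by simp
    also have "- aw_circ q a b c d z = (z - 1 / z) * (- aw_skew q a b c d z)"
      unfolding aw_circ_skew[OF assms] by simp
    finally show ?thesis .
  qed
  ultimately show ?thesis
    by (simp only: mult_cancel_left) simp
qed

text \<open>\<open>aw_circ\<close> times \<open>aw_factor\<close>, divided by \<open>1 / z - z\<close>, with the zeros at \<open>z = 1\<close> and
  \<open>z = -1\<close> cancelled.\<close>

definition aw_kernel :: "complex \<Rightarrow> complex \<Rightarrow> complex \<Rightarrow> complex \<Rightarrow> complex \<Rightarrow> complex \<Rightarrow> complex" where
  "aw_kernel q a b c d z = qpoch_inf (z\<^sup>2 * q) q * qpoch_inf (1 / z\<^sup>2) q /
     (z * ((qpoch_inf (a * z * q) q * qpoch_inf (a / z) q) * (qpoch_inf (b * z * q) q * qpoch_inf (b / z) q)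
         * (qpoch_inf (c * z * q) q * qpoch_inf (c / z) q) * (qpoch_inf (d * z * q) q * qpoch_inf (d / z) q)))"

lemma aw_kernel_eq:
  assumes "norm q < 1" "z \<noteq> 0" "a * z \<noteq> 1" "b * z \<noteq> 1" "c * z \<noteq> 1" "d * z \<noteq> 1"
  shows "aw_circ q a b c d z * aw_factor a b c d z = (1 / z - z) * aw_kernel q a b c d z"
proof -
  have Suc: "qpoch_inf w q = (1 - w) * qpoch_inf (w * q) q" for w
    by (rule qpoch_inf_Suc[OF assms(1)])
  have nz: "1 - a * z \<noteq> 0" "1 - b * z \<noteq> 0" "1 - c * z \<noteq> 0" "1 - d * z \<noteq> 0"
    using assms by auto
  define X where "X = (1 - a * z) * (1 - b * z) * (1 - c * z) * (1 - d * z)"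
  define Y where "Y = (qpoch_inf (a * z * q) q * qpoch_inf (a / z) q) * (qpoch_inf (b * z * q) q * qpoch_inf (b / z) q)
         * (qpoch_inf (c * z * q) q * qpoch_inf (c / z) q) * (qpoch_inf (d * z * q) q * qpoch_inf (d / z) q)"
  have "aw_pair q a z * aw_pair q b z * aw_pair q c z * aw_pair q d z = X * Y"
    unfolding aw_pair_def X_def Y_def
      Suc[of "a * z"] Suc[of "b * z"] Suc[of "c * z"] Suc[of "d * z"] by (simp only: mult_ac)
  then have 1: "aw_circ q a b c d z = (1 - z\<^sup>2) * (qpoch_inf (z\<^sup>2 * q) q * qpoch_inf (1 / z\<^sup>2) q) / (X * Y)"
    unfolding aw_circ_def Suc[of "z\<^sup>2"] by (simp only: mult.assoc)
  have 2: "aw_factor a b c d z = X / z\<^sup>2"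
    by (simp only: aw_factor_def X_def)
  have 3: "aw_kernel q a b c d z = (qpoch_inf (z\<^sup>2 * q) q * qpoch_inf (1 / z\<^sup>2) q) / (z * Y)"
    by (simp only: aw_kernel_def Y_def)
  have X: "X \<noteq> 0"
    using nz by (simp add: X_def)
  have 4: "(1 - z\<^sup>2) / z\<^sup>2 = (1 / z - z) / z"
    using assms(2) by (simp add: field_simps power2_eq_square)
  have "(1 - z\<^sup>2) * V / (X * Y) * (X / z\<^sup>2) = (1 / z - z) * (V / (z * Y))" for V
  proof -
    have "(1 - z\<^sup>2) * V / (X * Y) * (X / z\<^sup>2) = (1 - z\<^sup>2) / z\<^sup>2 * (V / Y)"
      using X by simp
    then show ?thesis
      unfolding 4 by simp
  qed
  then show ?thesis
    unfolding 1 2 3 .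
qed

text \<open>Together with \<open>aw_raise_sqrt\<close> this makes the kernel integrand a function of
  \<open>s * z\<close> alone, ready for a change of radius.\<close>

lemma aw_kernel_sqrt:
  assumes "s\<^sup>2 = q" "z \<noteq> 0" "s \<noteq> 0"
  shows "aw_kernel q a b c d z = s * aw_skew q (s * a) (s * b) (s * c) (s * d) (s * z)"
proof -
  have q: "q = s * s"
    using assms(1) by (simp add: power2_eq_square)
  have "aw_pair q (s * h) (s * z) = qpoch_inf (h * z * q) q * qpoch_inf (h / z) q" for h
    using assms(2,3) by (simp add: aw_pair_def q mult_ac)
  moreover have "(s * z)\<^sup>2 = z\<^sup>2 * q" "q / (z\<^sup>2 * q) = 1 / z\<^sup>2"
    using assms by (auto simp: power_mult_distrib)
  ultimately show ?thesis
    using assms(3) by (simp add: aw_kernel_def aw_skew_def)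
qed

text \<open>The sum of the two values is symmetric under \<open>w\<close> to \<open>1 / w\<close>,
  the difference antisymmetric and hence divisible by \<open>w - 1 / w\<close>, which lowers the
  degree by one. Both are needed in one induction, since multiplying \<open>p\<close> by the
  variable mixes them. Degrees are bounded by vanishing coefficients so that \<open>p = 0\<close>
  fits in.\<close>

lemma poly_dilate:
  assumes "s \<noteq> 0" "\<And>i. i \<ge> n \<Longrightarrow> coeff p i = 0"
  shows "\<exists>r t. (\<forall>w. w \<noteq> 0 \<longrightarrow>
      poly p ((w / s + s / w) / 2) + poly p ((w * s + 1 / (w * s)) / 2) = poly r ((w + 1 / w) / 2) \<and>
      poly p ((w / s + s / w) / 2) - poly p ((w * s + 1 / (w * s)) / 2) =
        (w - 1 / w) * poly t ((w + 1 / w) / 2)) \<and>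
    (\<forall>i\<ge>n. coeff r i = 0) \<and> (\<forall>i. Suc i \<ge> n \<longrightarrow> coeff t i = (0::complex))"
  using assms(2)
proof (induction p arbitrary: n)
  case 0
  then show ?case
    by (intro exI[of _ 0]) auto
next
  case (pCons k p)
  show ?case
  proof (cases n)
    case 0
    then have "pCons k p = 0"
      using pCons.prems by (intro poly_eqI) auto
    then show ?thesis
      using pCons.hyps by auto
  next
    case (Suc m)
    have "coeff p i = 0" if "i \<ge> m" for i
      using pCons.prems[of "Suc i"] that Suc by simp
    from pCons.IH[OF this] obtain r t where rt: "(\<forall>w. w \<noteq> 0 \<longrightarrow>
      poly p ((w / s + s / w) / 2) + poly p ((w * s + 1 / (w * s)) / 2) = poly r ((w + 1 / w) / 2) \<and>
      poly p ((w / s + s / w) / 2) - poly p ((w * s + 1 / (w * s)) / 2) =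
        (w - 1 / w) * poly t ((w + 1 / w) / 2)) \<and>
      (\<forall>i\<ge>m. coeff r i = 0) \<and> (\<forall>i. Suc i \<ge> m \<longrightarrow> coeff t i = 0)"
      by blast
    have
      r: "w \<noteq> 0 \<Longrightarrow>
        poly p ((w / s + s / w) / 2) + poly p ((w * s + 1 / (w * s)) / 2) = poly r ((w + 1 / w) / 2)"
      and t: "w \<noteq> 0 \<Longrightarrow> poly p ((w / s + s / w) / 2) - poly p ((w * s + 1 / (w * s)) / 2) =
        (w - 1 / w) * poly t ((w + 1 / w) / 2)"
      for w
      using rt by blast+
    have deg: "\<And>i. i \<ge> m \<Longrightarrow> coeff r i = 0" "\<And>i. Suc i \<ge> m \<Longrightarrow> coeff t i = 0"
      using rt by blast+
    \<comment> \<open>The constants come from \<open>x + y = 2 * \<sigma> * X\<close> and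
      \<open>x - y = 2 * \<delta> * (w - 1 / w)\<close> for the two arguments \<open>x\<close>,
      \<open>y\<close> below; \<open>r'\<close> and \<open>t'\<close> then follow from the product
      formulas 1 and 2.\<close>
    define \<sigma> where "\<sigma> = (s + 1 / s) / 2"
    define \<delta> where "\<delta> = (1 / s - s) / 4"
    define r' where "r' = [:2 * k:] + smult \<sigma> (pCons 0 r) + smult \<delta> (smult 4 (pCons 0 (pCons 0 t)) - smult 4 t)"
    define t' where "t' = smult \<sigma> (pCons 0 t) + smult \<delta> r"
    show ?thesis
    proof (rule exI[of _ r'], rule exI[of _ t'], intro conjI allI impI)
      fix w :: complex assume w: "w \<noteq> 0"
      define X where "X = (w + 1 / w) / 2"
      define x where "x = (w / s + s / w) / 2"
      define y where "y = (w * s + 1 / (w * s)) / 2"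
      define P where "P = poly p x"
      define M where "M = poly p y"
      have sum: "x + y = 2 * \<sigma> * X" and diff: "x - y = 2 * \<delta> * (w - 1 / w)"
        using w assms(1) by (simp_all add: x_def y_def \<sigma>_def \<delta>_def X_def field_simps)
      \<comment> \<open>The square of the antisymmetric factor is symmetric, hence a polynomial in
        \<open>X\<close>; it accounts for the terms with \<open>t\<close> in
        \<open>r'\<close>.\<close>
      have sq: "(w - 1 / w) * (w - 1 / w) = 4 * X * X - 4"
        using w by (simp add: X_def field_simps)
      have PM: "P + M = poly r X" "P - M = (w - 1 / w) * poly t X"
        unfolding P_def M_def X_def x_def y_def using r[OF w] t[OF w] by blast+
      have 1: "2 * (x * P + y * M) = (x + y) * (P + M) + (x - y) * (P - M)"
        and 2: "2 * (x * P - y * M) = (x + y) * (P - M) + (x - y) * (P + M)"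
        by (simp_all add: algebra_simps)
      have "2 * (x * P + y * M) = 2 * (\<sigma> * X * poly r X + \<delta> * ((w - 1 / w) * (w - 1 / w)) * poly t X)"
        unfolding 1 sum diff PM by (simp add: algebra_simps)
      then have "x * P + y * M = \<sigma> * X * poly r X + \<delta> * (4 * X * X - 4) * poly t X"
        unfolding sq mult_cancel_left by simp
      moreover have "2 * (x * P - y * M) = 2 * ((w - 1 / w) * (\<sigma> * X * poly t X + \<delta> * poly r X))"
        unfolding 2 sum diff PM by (simp add: algebra_simps)
      then have "x * P - y * M = (w - 1 / w) * (\<sigma> * X * poly t X + \<delta> * poly r X)"
        unfolding mult_cancel_left by simp
      ultimately show "poly (pCons k p) ((w / s + s / w) / 2) + poly (pCons k p) ((w * s + 1 / (w * s)) / 2) =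
            poly r' ((w + 1 / w) / 2)"
        "poly (pCons k p) ((w / s + s / w) / 2) - poly (pCons k p) ((w * s + 1 / (w * s)) / 2) =
            (w - 1 / w) * poly t' ((w + 1 / w) / 2)"
        unfolding r'_def t'_def poly_pCons X_def[symmetric] x_def[symmetric] y_def[symmetric]
          P_def[symmetric] M_def[symmetric]
        by (simp_all add: algebra_simps)
    next
      fix i assume "i \<ge> n"
      then show "coeff r' i = 0"
        using deg Suc by (auto simp: r'_def coeff_pCons split: nat.split)
    next
      fix i assume "Suc i \<ge> n"
      then show "coeff t' i = 0"
        using deg Suc by (auto simp: t'_def coeff_pCons split: nat.split)
    qed
  qed
qed

section \<open>Analyticity of the integrands and the induction for orthogonality\<close>

lemma norm_mult_unit_neq_1: "norm h < 1 \<Longrightarrow> norm z = 1 \<Longrightarrow> h * z \<noteq> (1 :: complex)"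
  by (metis mult.right_neutral norm_mult norm_one less_irrefl)

lemma holomorphic_on_aw_sum [holomorphic_intros]:
  assumes "0 \<notin> S"
  shows "(\<lambda>z. aw_sum q a b c d z n) holomorphic_on S"
proof -
  have "aw_sum q a b c d z n = (\<Sum>k=0..n. qbinom q n k *
      (qpoch (a * z) q k * qpoch (b * z) q k / (qpoch (a * b) q k * z ^ k) *
       (qpoch (c * (1 / z)) q (n - k) * qpoch (d * (1 / z)) q (n - k) * z ^ (n - k) / qpoch (c * d) q (n - k))))" for z
    by (simp add: aw_sum_def aw_half_def power_divide)
  moreover have "1 / (qpoch (a * b) q k * z ^ k) = 1 / qpoch (a * b) q k * (1 / z ^ k)" for z k
    by simp
  ultimately have "aw_sum q a b c d z n = (\<Sum>k=0..n. qbinom q n k / (qpoch (a * b) q k * qpoch (c * d) q (n - k)) *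
      ((\<Prod>i<k. 1 - a * z * q ^ i) * (\<Prod>i<k. 1 - b * z * q ^ i) / z ^ k *
       ((\<Prod>i<n - k. 1 - c * (1 / z) * q ^ i) * (\<Prod>i<n - k. 1 - d * (1 / z) * q ^ i) * z ^ (n - k))))" for z
    by (simp add: qpoch_def mult_ac)
  moreover have "z \<noteq> 0" if "z \<in> S" for z
    using that assms by auto
  ultimately show ?thesis
    by (simp only:) (intro holomorphic_intros, auto)
qed

lemma holomorphic_on_aw_skew:
  assumes "norm q < 1" "0 \<notin> S"
    "\<And>h z. h \<in> {a, b, c, d} \<Longrightarrow> z \<in> S \<Longrightarrow> norm (h * z) < 1 \<and> norm (h / z) < 1"
  shows "aw_skew q a b c d holomorphic_on S"
  unfolding aw_skew_def[abs_def] using assms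
  by (intro holomorphic_intros) (auto simp: aw_pair_nonzero)

lemma continuous_on_aw_circ:
  assumes "norm q < 1" "norm a < 1" "norm b < 1" "norm c < 1" "norm d < 1"
  shows "continuous_on (sphere 0 1) (aw_circ q a b c d)"
proof -
  have "aw_circ q a b c d holomorphic_on sphere 0 1"
    unfolding aw_circ_def[abs_def] using assms
    by (intro holomorphic_intros) (auto simp: aw_pair_nonzero norm_mult norm_divide)
  then show ?thesis
    by (rule holomorphic_on_imp_continuous_on)
qed

text \<open>The integrand is \<open>s ^ Suc n * F (s * z)\<close>. The circle is moved so that
  \<open>F z\<close> is integrated, and averaging with \<open>F (1 / z)\<close> replaces the
  polynomial by its divided difference, to which the hypothesis for \<open>n\<close> applies with
  all parameters multiplied by \<open>s\<close>.\<close>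

lemma circle_int_kernel_q_neq_0:
  assumes "norm q < 1" "q \<noteq> 0" "norm a < 1" "norm b < 1" "norm c < 1" "norm d < 1"
    and p: "\<And>i. i \<ge> Suc n \<Longrightarrow> coeff p i = 0"
    and IH: "\<And>a b c d p. norm a < 1 \<Longrightarrow> norm b < 1 \<Longrightarrow> norm c < 1 \<Longrightarrow> norm d < 1 \<Longrightarrow>
      (\<And>i. i \<ge> n \<Longrightarrow> coeff p i = 0) \<Longrightarrow>
      circle_int (\<lambda>z. aw_circ q a b c d z * aw_sum q a b c d z n * poly p ((z + 1 / z) / 2)) = 0"
  shows "circle_int (\<lambda>z. aw_kernel q a b c d z * aw_raise q a b c d z n * poly p ((z + 1 / z) / 2)) = 0"
proof -
  define s where "s = csqrt q"
  have s: "s\<^sup>2 = q" "s \<noteq> 0"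
    using assms(2) by (auto simp: s_def)
  have "norm s ^ 2 < 1 ^ 2"
    using assms(1) by (simp flip: s norm_power)
  then have s1: "norm s < 1"
    by (rule power_less_imp_less_base) simp
  define m where "m = max (max (norm a) (norm b)) (max (norm c) (norm d))"
  obtain M where M: "m < M" "M < 1"
    using dense[of m 1] assms by (auto simp: m_def)
  have hM: "norm h < M" if "h \<in> {a, b, c, d}" for h
    using that M by (auto simp: m_def)
  have "0 < M"
    using hM[of a] by (auto intro: order.strict_trans1[OF norm_ge_zero])
  \<comment> \<open>This radius lies below \<open>norm s\<close> and bounds the norms of all scaled
    parameters \<open>s * h\<close>; hence for \<open>r1 < norm w < 1 / r1\<close> no denominator
    vanishes, and the annulus contains both circles.\<close>
  define r1 where "r1 = norm s * M"
  define r2 where "r2 = 1 / r1"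
  have r1: "0 < r1" "r1 < norm s" "r1 < 1"
    using \<open>0 < M\<close> M s s1 by (auto simp: r1_def intro: order.strict_trans2[OF mult_strict_left_mono])
  then have r2: "1 < r2"
    by (simp add: r2_def)
  let ?A = "{w. r1 < norm w \<and> norm w < r2}"
  define f where "f w = aw_skew q (s * a) (s * b) (s * c) (s * d) w * aw_sum q (s * a) (s * b) (s * c) (s * d) w n" for w
  define F where "F w = f w * poly p ((w / s + s / w) / 2)" for w
  have small: "norm (h * z) < 1 \<and> norm (h / z) < 1" if hz: "h \<in> {s * a, s * b, s * c, s * d}" "z \<in> ?A" for h z
  proof -
    obtain k where k: "h = s * k" "k \<in> {a, b, c, d}"
      using hz(1) by blast
    have h: "norm h \<le> r1"
      unfolding k(1) r1_def norm_mult using hM[OF k(2)] by (intro mult_left_mono) auto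
    have "norm h * norm z \<le> r1 * norm z"
      using h by (intro mult_right_mono) auto
    also have "\<dots> < r1 * r2"
      using hz r1 by (intro mult_strict_left_mono) auto
    finally have "norm (h * z) < 1"
      using r1 by (simp add: norm_mult r2_def)
    moreover have "norm (h / z) < 1"
      using h hz r1 by (auto simp: norm_divide divide_simps)
    ultimately show ?thesis ..
  qed
  have 0: "0 \<notin> ?A"
    using r1 by auto
  have f_hol: "f holomorphic_on ?A"
    unfolding f_def[abs_def] using assms(1) small 0
    by (intro holomorphic_intros holomorphic_on_aw_skew) auto
  have F_hol: "F holomorphic_on ?A"
    unfolding F_def[abs_def] poly_altdef using f_hol 0 s(2)
    by (intro holomorphic_intros) auto
  have F_cont: "continuous_on (sphere 0 1) F"
    using F_hol r1 r2 by (intro holomorphic_on_imp_continuous_on holomorphic_on_subset[OF F_hol]) auto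
  have F_cont': "continuous_on (sphere 0 1) (\<lambda>z. F (1 / z))"
    by (rule continuous_on_compose2[OF F_cont]) (auto intro!: continuous_intros simp: norm_divide)
  have small1: "norm (s * h) < 1" if "norm h < 1" for h
    using norm_mult_less_1[OF s1 that] .
  have "aw_kernel q a b c d z * aw_raise q a b c d z n * poly p ((z + 1 / z) / 2) = s ^ Suc n * F (s * z)"
    if "norm z = 1" for z
  proof -
    have "z \<noteq> 0"
      using that by auto
    then show ?thesis
      unfolding aw_kernel_sqrt[OF s(1) \<open>z \<noteq> 0\<close> s(2)] aw_raise_sqrt[OF s(1) \<open>z \<noteq> 0\<close> s(2)]
      using s by (simp add: F_def f_def)
  qed
  then have "circle_int (\<lambda>z. aw_kernel q a b c d z * aw_raise q a b c d z n * poly p ((z + 1 / z) / 2)) =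
      s ^ Suc n * circle_int (\<lambda>z. F (s * z))"
    by (subst circle_int_cmult[symmetric]) (rule circle_int_cong)
  also have "circle_int (\<lambda>z. F (s * z)) = circle_int F"
    by (rule circle_int_dilate[OF F_hol r1(1,3) r2 r1(2) less_trans[OF s1 r2]])
  also have "circle_int F = 0"
  proof -
    obtain t where t: "\<And>w. w \<noteq> 0 \<Longrightarrow> poly p ((w / s + s / w) / 2) - poly p ((w * s + 1 / (w * s)) / 2) =
        (w - 1 / w) * poly t ((w + 1 / w) / 2)" and t0: "\<And>i. Suc i \<ge> Suc n \<Longrightarrow> coeff t i = 0"
      using poly_dilate[OF s(2), of "Suc n" p] p by blast
    \<comment> \<open>Inversion changes the sign of \<open>f\<close> and exchanges the two
      polynomial arguments, so symmetrising produces their difference.\<close>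
    have "circle_int F + circle_int F = circle_int (\<lambda>z. F z + F (1 / z))"
      using F_cont F_cont' by (simp add: circle_int_add circle_int_inverse)
    also have "\<dots> = circle_int (\<lambda>z. aw_circ q (s * a) (s * b) (s * c) (s * d) z
        * aw_sum q (s * a) (s * b) (s * c) (s * d) z n * poly t ((z + 1 / z) / 2))"
    proof (rule circle_int_cong)
      fix z :: complex assume "norm z = 1"
      then have z: "z \<noteq> 0"
        by auto
      have "norm (s * a * (s * b)) < 1" "norm (s * c * (s * d)) < 1"
        using small1 assms(3-6) by (simp_all only: norm_mult_less_1)
      from aw_sum_inverse[OF assms(1) this z] have f: "f (1 / z) = - f z"
        unfolding f_def aw_skew_inverse[OF assms(1) z] by simp
      have e: "(1 / z / s + s / (1 / z)) / 2 = (z * s + 1 / (z * s)) / 2"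
        by simp
      have "F z + F (1 / z) = f z * (poly p ((z / s + s / z) / 2) - poly p ((z * s + 1 / (z * s)) / 2))"
        unfolding F_def f e right_diff_distrib by simp
      then have "F z + F (1 / z) = f z * ((z - 1 / z) * poly t ((z + 1 / z) / 2))"
        unfolding t[OF z] .
      then show "F z + F (1 / z) = aw_circ q (s * a) (s * b) (s * c) (s * d) z
        * aw_sum q (s * a) (s * b) (s * c) (s * d) z n * poly t ((z + 1 / z) / 2)"
        unfolding aw_circ_skew[OF assms(1) z] f_def by (simp only: mult_ac)
    qed
    also have "\<dots> = 0"
      using small1 assms t0 by (intro IH) auto
    finally show ?thesis
      by simp
  qed
  finally show ?thesis
    by simp
qed

lemma circle_int_kernel_q_0:
  assumes "norm a < 1" "norm b < 1" "norm c < 1" "norm d < 1"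
    and p: "\<And>i. i \<ge> Suc n \<Longrightarrow> coeff p i = 0"
  shows "circle_int (\<lambda>z. aw_kernel 0 a b c d z * aw_raise 0 a b c d z n * poly p ((z + 1 / z) / 2)) = 0"
proof -
  define m where "m = max (max (norm a) (norm b)) (max (norm c) (norm d))"
  obtain M where M: "m < M" "M < 1"
    using dense[of m 1] assms by (auto simp: m_def)
  have hM: "norm h < M" if "h \<in> {a, b, c, d}" for h
    using that M by (auto simp: m_def)
  have "0 < M"
    using hM[of a] by (auto intro: order.strict_trans1[OF norm_ge_zero])
  have nz: "1 - h * z \<noteq> 0" if "h \<in> {a, b, c, d}" "z \<in> ball 0 (1 / M)" for h z
  proof -
    have "norm h * norm z \<le> M * norm z"
      using hM[OF that(1)] by (intro mult_right_mono) auto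
    also have "\<dots> < M * (1 / M)"
      using that(2) \<open>0 < M\<close> by (intro mult_strict_left_mono) auto
    finally have "norm (h * z) < 1"
      using \<open>0 < M\<close> by (simp add: norm_mult)
    then show ?thesis
      by auto
  qed
  define F where "F z = (1 - z\<^sup>2) / ((1 - a * z) * (1 - b * z) * (1 - c * z) * (1 - d * z))
    * (\<Sum>i\<le>n. coeff p i * (z ^ (n - i) * ((z\<^sup>2 + 1) / 2) ^ i))" for z
  have poly: "poly p x = (\<Sum>i\<le>n. coeff p i * x ^ i)" for x
    unfolding poly_altdef using p
    by (intro sum.mono_neutral_left) (auto simp: coeff_eq_0 not_less_eq_eq intro: degree_le)
  have "circle_int (\<lambda>z. aw_kernel 0 a b c d z * aw_raise 0 a b c d z n * poly p ((z + 1 / z) / 2)) =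
      circle_int (\<lambda>z. aw_kernel 0 a b c d (1 / z) * aw_raise 0 a b c d (1 / z) n * poly p ((1 / z + 1 / (1 / z)) / 2))"
    by (rule circle_int_inverse[symmetric])
  also have "\<dots> = circle_int (\<lambda>z. z * F z)"
  proof (rule circle_int_cong)
    fix z :: complex assume "norm z = 1"
    then have z: "z \<noteq> 0"
      by auto
    have "z ^ n * poly p ((1 / z + z) / 2) = (\<Sum>i\<le>n. coeff p i * (z ^ (n - i) * ((z\<^sup>2 + 1) / 2) ^ i))"
      unfolding poly sum_distrib_left
    proof (intro sum.cong refl)
      fix i assume "i \<in> {..n}"
      then have "z ^ n = z ^ (n - i) * z ^ i"
        by (simp flip: power_add)
      moreover have "z * ((1 / z + z) / 2) = (z\<^sup>2 + 1) / 2"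
        using z by (simp add: field_simps power2_eq_square)
      then have "z ^ i * ((1 / z + z) / 2) ^ i = ((z\<^sup>2 + 1) / 2) ^ i"
        by (metis power_mult_distrib)
      ultimately show "z ^ n * (coeff p i * ((1 / z + z) / 2) ^ i) = coeff p i * (z ^ (n - i) * ((z\<^sup>2 + 1) / 2) ^ i)"
        by (metis mult.assoc mult.left_commute)
    qed
    moreover have "aw_kernel 0 a b c d (1 / z) = z * ((1 - z\<^sup>2) / ((1 - a * z) * (1 - b * z) * (1 - c * z) * (1 - d * z)))"
      using z by (simp add: aw_kernel_def qpoch_inf_0_right power_divide)
    moreover have "aw_raise 0 a b c d (1 / z) n = z ^ n"
      by (simp add: aw_raise_q_0 power_divide)
    ultimately show "aw_kernel 0 a b c d (1 / z) * aw_raise 0 a b c d (1 / z) n * poly p ((1 / z + 1 / (1 / z)) / 2) = z * F z"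
      by (simp add: F_def)
  qed
  also have "\<dots> = 0"
  proof (rule circle_int_disc)
    show "F holomorphic_on ball 0 (1 / M)"
      unfolding F_def[abs_def] using nz by (intro holomorphic_intros) auto
    show "1 / M > 1"
      using \<open>0 < M\<close> M by simp
  qed
  finally show ?thesis .
qed

lemma continuous_on_kernel:
  assumes "norm q < 1" "norm a < 1" "norm b < 1" "norm c < 1" "norm d < 1"
  shows "continuous_on (sphere 0 1) (\<lambda>z. aw_kernel q a b c d z * aw_raise q a b c d z n * poly p ((z + 1 / z) / 2))"
proof -
  have "norm (h * z * q) < 1" if "norm h < 1" "norm z = 1" for h z
    using that assms(1) norm_mult_less_1[of h q] by (simp add: norm_mult mult_ac)
  then have nz: "qpoch_inf (h * z * q) q \<noteq> 0" "qpoch_inf (h / z) q \<noteq> 0" if "norm h < 1" "norm z = 1" for h z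
    using that assms(1) by (simp_all add: qpoch_inf_nonzero norm_divide)
  have kernel: "aw_kernel q a b c d holomorphic_on sphere 0 1"
    unfolding aw_kernel_def[abs_def] using nz assms
    by (intro holomorphic_intros) auto
  have "aw_raise q a b c d z n = (\<Sum>k=0..n. qbinom q n k * q ^ (n - k) / (qpoch (a * b * q) q k * qpoch (c * d * q) q (n - k)) *
        ((\<Prod>i<k. 1 - a * z * q * q ^ i) * (\<Prod>i<k. 1 - b * z * q * q ^ i) / z ^ k *
         ((\<Prod>i<n - k. 1 - c / z * q ^ i) * (\<Prod>i<n - k. 1 - d / z * q ^ i) * z ^ (n - k))))" for z
    by (simp add: aw_raise_def qpoch_def mult_ac)
  then have raise: "(\<lambda>z. aw_raise q a b c d z n) holomorphic_on sphere 0 1"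
    by (simp only:) (intro holomorphic_intros, auto)
  have "(\<lambda>z. aw_kernel q a b c d z * aw_raise q a b c d z n * poly p ((z + 1 / z) / 2)) holomorphic_on sphere 0 1"
    unfolding poly_altdef using kernel raise by (intro holomorphic_intros) auto
  then show ?thesis
    by (rule holomorphic_on_imp_continuous_on)
qed

text \<open>By the raising relation the integral is, up to a nonzero constant, a sum of two kernel
  integrals, each of which vanishes. Parameters and polynomial vary in the induction, because the
  kernel step scales the former and differences the latter.\<close>

theorem circle_int_aw_sum:
  assumes "norm q < 1" "norm a < 1" "norm b < 1" "norm c < 1" "norm d < 1"
    and "\<And>i. i \<ge> n \<Longrightarrow> coeff p i = 0"
  shows "circle_int (\<lambda>z. aw_circ q a b c d z * aw_sum q a b c d z n * poly p ((z + 1 / z) / 2)) = 0"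
  using assms(2-)
proof (induction n arbitrary: a b c d p)
  case 0
  then have "p = 0"
    by (intro poly_eqI) simp
  then show ?case
    by (simp add: circle_int_def)
next
  case (Suc n)
  define k where "k a b c d z = aw_kernel q a b c d z * aw_raise q a b c d z n * poly p ((z + 1 / z) / 2)" for a b c d z
  have k0: "circle_int (k a b c d) = 0"
    if "norm a < 1" "norm b < 1" "norm c < 1" "norm d < 1" for a b c d
  proof (cases "q = 0")
    case True
    then show ?thesis
      using circle_int_kernel_q_0[OF that, of n p] Suc.prems(5) by (simp add: k_def[abs_def])
  next
    case False
    show ?thesis
      unfolding k_def
      by (rule circle_int_kernel_q_neq_0[OF assms(1) False that Suc.prems(5)]) (use Suc.IH in blast)+
  qed
  have ab: "norm (a * b) < 1" "norm (c * d) < 1"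
    using Suc.prems by (simp_all add: norm_mult_less_1)
  define K where "K = (1 - a * b) * (1 - c * d)"
  have "K \<noteq> 0"
    using ab by (auto simp: K_def)
  have "K * circle_int (\<lambda>z. aw_circ q a b c d z * aw_sum q a b c d z (Suc n) * poly p ((z + 1 / z) / 2)) =
      circle_int (\<lambda>z. k a b c d z + k c d a b (1 / z))"
    unfolding circle_int_cmult[symmetric]
  proof (rule circle_int_spike)
    fix z :: complex assume z: "norm z = 1" "z \<noteq> 1" "z \<noteq> -1"
    then have "z \<noteq> 0"
      by auto
    have "z\<^sup>2 \<noteq> 1"
      using z by (simp add: power2_eq_1_iff)
    then have nz: "1 / z - z \<noteq> 0"
      using \<open>z \<noteq> 0\<close> by (simp add: field_simps power2_eq_square)
    have z': "norm (1 / z) = 1" "1 / z \<noteq> 0"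
      using z \<open>z \<noteq> 0\<close> by (simp_all add: norm_divide)
    define g where "g = poly p ((z + 1 / z) / 2)"
    have 1: "aw_circ q a b c d z * aw_factor a b c d z = (1 / z - z) * aw_kernel q a b c d z"
      using assms(1) Suc.prems z \<open>z \<noteq> 0\<close> by (intro aw_kernel_eq) (auto simp: norm_mult_unit_neq_1)
    \<comment> \<open>At \<open>1 / z\<close> the divisor \<open>1 / z - z\<close> changes sign,
      which turns the difference in \<open>aw_raising\<close> into a sum of kernels.\<close>
    have "aw_circ q c d a b (1 / z) * aw_factor c d a b (1 / z) = (1 / (1 / z) - 1 / z) * aw_kernel q c d a b (1 / z)"
      using assms(1) Suc.prems z' by (intro aw_kernel_eq norm_mult_unit_neq_1) auto
    then have 2: "aw_circ q a b c d z * aw_factor c d a b (1 / z) = - ((1 / z - z) * aw_kernel q c d a b (1 / z))"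
      by (simp add: aw_circ_swap[of q c d a b] algebra_simps)
    have "(1 / z - z) * (K * (aw_circ q a b c d z * aw_sum q a b c d z (Suc n) * g)) =
        aw_circ q a b c d z * (K * ((1 / z - z) * aw_sum q a b c d z (Suc n))) * g"
      by (simp only: mult_ac)
    also have "\<dots> = (aw_circ q a b c d z * aw_factor a b c d z) * aw_raise q a b c d z n * g
        - (aw_circ q a b c d z * aw_factor c d a b (1 / z)) * aw_raise q c d a b (1 / z) n * g"
      unfolding K_def aw_raising[OF assms(1) ab \<open>z \<noteq> 0\<close>] by (simp add: algebra_simps)
    also have "\<dots> = (1 / z - z) * (aw_kernel q a b c d z * aw_raise q a b c d z n * g
        + aw_kernel q c d a b (1 / z) * aw_raise q c d a b (1 / z) n * g)"
      unfolding 1 2 by (simp only: distrib_left mult_minus_left diff_minus_eq_add mult.assoc)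
    finally have "K * (aw_circ q a b c d z * aw_sum q a b c d z (Suc n) * g) =
        aw_kernel q a b c d z * aw_raise q a b c d z n * g
        + aw_kernel q c d a b (1 / z) * aw_raise q c d a b (1 / z) n * g"
      unfolding mult_cancel_left using nz by blast
    then show "K * (aw_circ q a b c d z * aw_sum q a b c d z (Suc n) * poly p ((z + 1 / z) / 2)) =
        k a b c d z + k c d a b (1 / z)"
      unfolding k_def g_def by (simp add: add.commute)
  qed
  also have "\<dots> = circle_int (k a b c d) + circle_int (\<lambda>z. k c d a b (1 / z))"
  proof (rule circle_int_add)
    show "continuous_on (sphere 0 1) (k a b c d)"
      unfolding k_def using assms(1) Suc.prems by (intro continuous_on_kernel)
    have "continuous_on (sphere 0 1) (k c d a b)"
      unfolding k_def using assms(1) Suc.prems by (intro continuous_on_kernel)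
    then show "continuous_on (sphere 0 1) (\<lambda>z. k c d a b (1 / z))"
      by (rule continuous_on_compose2) (auto intro!: continuous_intros simp: norm_divide)
  qed
  also have "\<dots> = 0"
    using k0 Suc.prems by (simp add: circle_int_inverse)
  finally show ?case
    using \<open>K \<noteq> 0\<close> by simp
qed

section \<open>The weight on the interval\<close>

lemma aw_weight_eq: "aw_weight a b c d q x =
    1 / complex_of_real (sqrt (1 - x\<^sup>2)) * aw_circ q a b c d (cis (arccos x))"
proof -
  have 1: "cis (2 * t) = (cis t)\<^sup>2" for t
    by (simp add: power2_eq_square cis_mult)
  then have 2: "cis (- (2 * t)) = 1 / (cis t)\<^sup>2" for t
    by (simp only: cis_inverse[symmetric] inverse_eq_divide)
  have 3: "h * cis (- t) = h / cis t" for t and h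
    by (simp only: cis_inverse[symmetric] divide_inverse)
  show ?thesis
    unfolding aw_weight_def aw_circ_def aw_pair_def Let_def 1 2 3 by simp
qed

text \<open>The integral against the weight after \<open>x = cos t\<close>: the singular factor of
  the weight cancels against the differential, and the integrand becomes continuous.\<close>

definition aw_integral :: "complex \<Rightarrow> complex \<Rightarrow> complex \<Rightarrow> complex \<Rightarrow> complex \<Rightarrow> complex poly \<Rightarrow> complex" where
  "aw_integral q a b c d f = integral {0..pi} (\<lambda>t. poly f (complex_of_real (cos t)) * aw_circ q a b c d (cis t))"

context
  fixes q a b c d :: complex
  assumes small: "norm q < 1" "norm a < 1" "norm b < 1" "norm c < 1" "norm d < 1"
begin

lemma continuous_on_aw_integrand:
  "continuous_on S (\<lambda>t. poly f (complex_of_real (cos t)) * aw_circ q a b c d (cis t))"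
proof -
  have "continuous_on S (\<lambda>t. aw_circ q a b c d (cis t))"
    by (rule continuous_on_compose2[OF continuous_on_aw_circ[OF small]]) (auto intro!: continuous_intros)
  then show ?thesis
    by (intro continuous_intros)
qed

lemma has_integral_aw_weight:
  "((\<lambda>x::real. poly f (complex_of_real x) * aw_weight a b c d q x) has_integral aw_integral q a b c d f) {-1..1}"
proof -
  let ?F = "\<lambda>t. poly f (complex_of_real (cos t)) * aw_circ q a b c d (cis t)"
  have range: "arccos ` {-1..1} \<subseteq> {0..pi}"
    by (auto simp: arccos_lbound arccos_ubound)
  have deriv: "(arccos has_real_derivative inverse (- sqrt (1 - x\<^sup>2))) (at x within {-1..1})"
    if "x \<in> {-1..1} - {-1, 1}" for x
    using that by (intro has_field_derivative_at_within[OF DERIV_arccos]) auto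
  \<comment> \<open>As \<open>arccos\<close> decreases from \<open>pi\<close> to 0, the first of the
    two integrals is over an empty interval; the sign left by the second is removed by negation. The
    points -1 and 1 form the finite exceptional set.\<close>
  have "((\<lambda>x. inverse (- sqrt (1 - x\<^sup>2)) *\<^sub>R ?F (arccos x)) has_integral
      (integral {arccos (-1)..arccos 1} ?F - integral {arccos 1..arccos (-1)} ?F)) {-1..1}"
    using has_integral_substitution_general[where f = ?F, OF _ _ range continuous_on_aw_integrand
        continuous_on_arccos' deriv, of "{-1, 1}"] by simp
  from has_integral_neg[OF this]
  have "((\<lambda>x. - (inverse (- sqrt (1 - x\<^sup>2)) *\<^sub>R ?F (arccos x))) has_integral aw_integral q a b c d f) {-1..1}"
    by (simp add: aw_integral_def)
  then show ?thesis
    by (rule has_integral_eq[rotated])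
      (simp add: aw_weight_eq scaleR_conv_of_real divide_inverse)
qed

lemma aw_integral_eq_circle_int:
  "aw_integral q a b c d f = circle_int (\<lambda>z. aw_circ q a b c d z * poly f ((z + 1 / z) / 2)) / 2"
proof -
  let ?F = "\<lambda>z. aw_circ q a b c d z * poly f ((z + 1 / z) / 2)"
  have "(cis t + 1 / cis t) / 2 = complex_of_real (cos t)" for t
    unfolding inverse_eq_divide[symmetric] cis_inverse by (simp add: complex_eq_iff)
  then have "aw_integral q a b c d f = integral {0..pi} (\<lambda>t. ?F (cis t))"
    unfolding aw_integral_def by (simp only: mult.commute)
  also have "\<dots> = circle_int ?F / 2"
  proof (rule integral_0_pi_eq_circle_int)
    show "continuous_on (sphere 0 1) ?F"
      by (intro continuous_intros continuous_on_aw_circ small) auto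
  qed (simp add: add.commute)
  finally show ?thesis .
qed

lemma aw_integral_add: "aw_integral q a b c d (f + g) = aw_integral q a b c d f + aw_integral q a b c d g"
  unfolding aw_integral_def
  by (subst integral_add[symmetric])
    (auto intro!: integrable_continuous_interval continuous_on_aw_integrand simp: distrib_right)

lemma aw_integral_smult: "aw_integral q a b c d (smult k f) = k * aw_integral q a b c d f"
  unfolding aw_integral_def by (subst integral_mult_right[symmetric]) (simp add: mult.assoc)

lemma is_aw_system_iff:
  "is_aw_system a b c d q D \<longleftrightarrow> (\<forall>n. degree (D n) = n \<and> lead_coeff (D n) = 2 ^ n) \<and>
     (\<forall>m n. m \<noteq> n \<longrightarrow> aw_integral q a b c d (D m * D n) = 0)"
proof -
  have "((\<lambda>x::real. poly (D m) (complex_of_real x) * poly (D n) (complex_of_real x) * aw_weight a b c d q x)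
      has_integral 0) {-1..1} \<longleftrightarrow> aw_integral q a b c d (D m * D n) = 0" for m n
    using has_integral_aw_weight[of "D m * D n"] by (auto simp: has_integral_unique)
  then show ?thesis
    by (simp add: is_aw_system_def)
qed

text \<open>The polynomials \<open>D m\<close> with \<open>m < n\<close> span all polynomials of
  degree below \<open>n\<close>: subtracting a multiple of \<open>D m\<close> removes the
  coefficient at \<open>m\<close>.\<close>

lemma aw_system_orthogonal:
  assumes "is_aw_system a b c d q D" "\<And>i. i \<ge> n \<Longrightarrow> coeff p i = 0"
  shows "aw_integral q a b c d (D n * p) = 0"
proof -
  have "aw_integral q a b c d (D n * p) = 0" if "m \<le> n" "\<And>i. i \<ge> m \<Longrightarrow> coeff p i = 0" for m p
    using that
  proof (induction m arbitrary: p)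
    case 0
    then have "p = 0"
      by (intro poly_eqI) simp
    then show ?case
      by (simp add: aw_integral_def)
  next
    case (Suc m)
    have D: "degree (D m) = m" "coeff (D m) m = 2 ^ m"
      using assms(1) by (auto simp: is_aw_system_iff) metis
    define k where "k = coeff p m / 2 ^ m"
    have "coeff (p - smult k (D m)) i = 0" if "i \<ge> m" for i
      using that Suc.prems D by (cases "i = m") (auto simp: k_def coeff_eq_0)
    then have "aw_integral q a b c d (D n * (p - smult k (D m))) = 0"
      using Suc.prems by (intro Suc.IH) auto
    moreover have "aw_integral q a b c d (D n * D m) = 0"
      using assms(1) Suc.prems by (auto simp: is_aw_system_iff)
    moreover have "D n * p = D n * (p - smult k (D m)) + smult k (D n * D m)"
      by (simp add: algebra_simps)
    ultimately show ?case
      by (simp only: aw_integral_add aw_integral_smult) simp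
  qed
  then show ?thesis
    using assms(2) by blast
qed

end

text \<open>For parameters closed under conjugation the weight is real and of constant sign, so the
  integral of \<open>f\<close> times its conjugate can vanish only if \<open>f\<close> is zero on an
  open interval. The conjugate enters through \<open>map_poly cnj\<close> because the form itself is
  bilinear.\<close>

lemma aw_integral_definite:
  fixes q :: real
  assumes "\<bar>q\<bar> < 1" "norm a < 1" "norm b < 1" "norm c < 1" "norm d < 1"
    and cnj: "image_mset cnj {#a, b, c, d#} = {#a, b, c, d#}"
    and 0: "aw_integral q a b c d (f * map_poly cnj f) = 0"
  shows "f = 0"
proof -
  let ?q = "complex_of_real q"
  have q: "norm ?q < 1"
    using assms(1) by simp
  define N where "N t = (norm (qpoch_inf ((cis t)\<^sup>2) ?q))\<^sup>2" for t
  define Den where "Den t = aw_pair ?q a (cis t) * aw_pair ?q b (cis t) * aw_pair ?q c (cis t) * aw_pair ?q d (cis t)" for t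
  define \<delta> where "\<delta> t = Re (Den t)" for t
  have cnj_inf: "cnj (qpoch_inf z ?q) = qpoch_inf (cnj z) ?q" for z
    using qpoch_inf_cnj[OF q, of z] by simp
  have cnj_pair: "cnj (aw_pair ?q h (cis t)) = aw_pair ?q (cnj h) (cis t)" for h t
  proof -
    have "cnj (h * cis t) = cnj h / cis t" "cnj (h / cis t) = cnj h * cis t"
      by (simp_all add: divide_inverse cis_cnj)
    then show ?thesis
      unfolding aw_pair_def by (subst complex_cnj_mult) (simp only: cnj_inf mult.commute)
  qed
  \<comment> \<open>As a product over the multiset of parameters the denominator is visibly
    unchanged by conjugation, whichever parameters are paired.\<close>
  have Den_mset: "Den t = prod_mset (image_mset (\<lambda>h. aw_pair ?q h (cis t)) {#a, b, c, d#})" for t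
    by (simp add: Den_def mult_ac)
  have "cnj (Den t) = prod_mset (image_mset (\<lambda>h. aw_pair ?q h (cis t)) (image_mset cnj {#a, b, c, d#}))" for t
    by (simp add: Den_def cnj_pair mult_ac)
  then have "cnj (Den t) = Den t" for t
    unfolding cnj Den_mset[symmetric] .
  then have Den: "Den t = complex_of_real (\<delta> t)" for t
    unfolding \<delta>_def by (simp add: Reals_cnj_iff)
  have "aw_pair ?q h (cis t) \<noteq> 0" if "norm h < 1" for h t
    using aw_pair_nonzero[OF q, of h "cis t"] that by (simp add: norm_mult norm_divide)
  then have "Den t \<noteq> 0" for t
    using assms(2-5) by (simp add: Den_def)
  then have \<delta>0: "\<delta> t \<noteq> 0" for t
    by (simp add: Den)
  have "continuous_on UNIV Den"
    unfolding Den_def[abs_def] aw_pair_def using q by (intro continuous_intros) auto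
  then have \<delta>_cont: "continuous_on S \<delta>" for S
    unfolding \<delta>_def[abs_def] by (intro continuous_intros) (rule continuous_on_subset, auto)
  have conn: "connected (\<delta> ` {0..pi})"
    by (intro connected_continuous_image \<delta>_cont) simp
  \<comment> \<open>The image of the interval under \<open>\<delta>\<close> is connected and omits
    0, so \<open>\<delta>\<close> keeps the sign it has at 0.\<close>
  have sgn: "sgn (\<delta> 0) * \<delta> t > 0" if "t \<in> {0..pi}" for t
  proof -
    have im: "0 \<notin> \<delta> ` {0..pi}"
      using \<delta>0 by (metis imageE)
    have t: "\<delta> t \<in> \<delta> ` {0..pi}" "\<delta> 0 \<in> \<delta> ` {0..pi}"
      using that by (blast, simp)
    have "0 \<notin> {\<delta> 0..\<delta> t}" "0 \<notin> {\<delta> t..\<delta> 0}"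
      using connected_contains_Icc[OF conn t(2,1)] connected_contains_Icc[OF conn t] im by blast+
    moreover have "\<delta> 0 \<noteq> 0"
      by (rule \<delta>0)
    ultimately show ?thesis
      by (cases "\<delta> 0 > 0") (simp_all add: not_le not_less)
  qed
  define g where "g t = (norm (poly f (complex_of_real (cos t))))\<^sup>2 * N t / (sgn (\<delta> 0) * \<delta> t)" for t
  have circ: "aw_circ ?q a b c d (cis t) = complex_of_real (N t / \<delta> t)" for t
  proof -
    have "cnj ((cis t)\<^sup>2) = 1 / (cis t)\<^sup>2"
      unfolding complex_cnj_power cis_cnj cis_inverse[symmetric]
      by (simp only: inverse_eq_divide power_divide power_one)
    then have "qpoch_inf ((cis t)\<^sup>2) ?q * qpoch_inf (1 / (cis t)\<^sup>2) ?q = complex_of_real (N t)"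
      by (simp only: N_def complex_norm_square cnj_inf)
    then show ?thesis
      using Den[of t] by (simp add: aw_circ_def Den_def)
  qed
  have "poly (f * map_poly cnj f) (complex_of_real (cos t)) * aw_circ ?q a b c d (cis t) =
      complex_of_real (sgn (\<delta> 0)) * complex_of_real (g t)" for t
  proof -
    have "poly (map_poly cnj f) (complex_of_real (cos t)) = cnj (poly f (complex_of_real (cos t)))"
      by (simp only: poly_cnj complex_cnj_complex_of_real)
    then have "poly (f * map_poly cnj f) (complex_of_real (cos t)) =
        complex_of_real ((norm (poly f (complex_of_real (cos t))))\<^sup>2)"
      by (simp only: poly_mult complex_norm_square)
    then show ?thesis
      using \<delta>0[of 0] unfolding circ g_def by (simp add: sgn_if)
  qed
  then have int: "complex_of_real (sgn (\<delta> 0)) * integral {0..pi} (\<lambda>t. complex_of_real (g t)) = 0"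
    using 0 by (simp add: aw_integral_def)
  have g_cont: "continuous_on {0..pi} g"
    unfolding g_def[abs_def] N_def using q \<delta>0 by (intro continuous_intros \<delta>_cont) (auto simp: sgn_zero_iff)
  have "integral {0..pi} g = 0"
  proof -
    have "((\<lambda>t. complex_of_real (g t)) has_integral complex_of_real (integral {0..pi} g)) {0..pi}"
      by (intro has_integral_of_real integrable_integral integrable_continuous_interval g_cont)
    then show ?thesis
      using int \<delta>0[of 0] by (auto simp: integral_unique sgn_if split: if_splits)
  qed
  then have g0: "g t = 0" if "t \<in> {0..pi}" for t
    using that integral_eq_0_iff[OF g_cont pi_gt_zero] sgn
    by (auto simp: g_def N_def less_imp_le)
  have root: "poly f (complex_of_real x) = 0" if x: "x \<in> {-1<..<1}" for x
  proof -
    define t where "t = arccos x"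
    have t: "0 < t" "t < pi" "cos t = x"
      using x arccos_lt_bounded[of x] by (auto simp: t_def)
    \<comment> \<open>The numerator \<open>N\<close> vanishes only where
      \<open>(cis t)\<^sup>2 = 1\<close>, that is, at the end points of the interval.\<close>
    have "(cis t)\<^sup>2 \<noteq> 1"
    proof
      assume "(cis t)\<^sup>2 = 1"
      then have "cis t = 1 \<or> cis t = -1"
        by (simp only: power2_eq_1_iff)
      then have "Im (cis t) = 0"
        by (elim disjE; simp only: one_complex.simps uminus_complex.simps minus_zero)
      then show False
        using t sin_gt_zero[of t] by simp
    qed
    then have "qpoch_inf ((cis t)\<^sup>2) ?q \<noteq> 0"
      using q by (intro qpoch_inf_nonzero') (auto simp: norm_power)
    then show ?thesis
      using g0[of t] sgn[of t] t by (auto simp: g_def N_def)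
  qed
  show "f = 0"
  proof (rule ccontr)
    assume "f \<noteq> 0"
    then have "finite {x. poly f x = 0}"
      by (rule poly_roots_finite)
    then have "finite (complex_of_real ` {-1<..<1})"
      by (rule finite_subset[rotated]) (use root in auto)
    then have "finite {-1<..<1::real}"
      by (rule finite_imageD) (simp add: inj_on_def)
    moreover have "infinite {-1<..<1::real}"
      by (rule infinite_Ioo) simp
    ultimately show False
      by contradiction
  qed
qed

text \<open>The normalised sums form an orthogonal system, and definiteness shows that it is the
  only one; hence the description in \<open>aw_poly\<close> denotes it. The identity then holds for
  all complex \<open>x\<close>, not only on the interval.\<close>

lemma aw_poly_sum:
  fixes q :: real
  assumes "\<bar>q\<bar> < 1" "norm a < 1" "norm b < 1" "norm c < 1" "norm d < 1"
    and cnj: "image_mset cnj {#a, b, c, d#} = {#a, b, c, d#}"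
    and z: "z \<noteq> 0" "2 * x = z + 1 / z"
  shows "poly (aw_poly n a b c d q) x =
    qpoch (a * b) q n * qpoch (c * d) q n / qpoch (a * b * c * d * q ^ (n - 1)) q n * aw_sum q a b c d z n"
proof -
  let ?q = "complex_of_real q"
  have q: "norm ?q < 1"
    using assms(1) by simp
  note small = q assms(2-5)
  have ab: "norm (a * b) < 1" "norm (c * d) < 1"
    using assms by (simp_all add: norm_mult_less_1)
  obtain p where p: "\<And>n z. z \<noteq> 0 \<Longrightarrow> poly (p n) ((z + 1 / z) / 2) = aw_sum ?q a b c d z n" "\<And>n. degree (p n) \<le> n"
    "\<And>n. coeff (p n) n = 2 ^ n * (qpoch (a * b * c * d * ?q ^ (n - 1)) ?q n / (qpoch (a * b) ?q n * qpoch (c * d) ?q n))"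
    using aw_sum_poly[OF q ab] by metis
  define \<kappa> where "\<kappa> n = qpoch (a * b) ?q n * qpoch (c * d) ?q n / qpoch (a * b * c * d * ?q ^ (n - 1)) ?q n" for n
  define D where "D n = smult (\<kappa> n) (p n)" for n
  have "norm (a * b * c * d * ?q ^ m) < 1" for m
  proof -
    have "norm (a * b * (c * d)) * norm ?q ^ m \<le> norm (a * b * (c * d)) * 1"
      using q by (intro mult_left_mono power_le_one) auto
    then show ?thesis
      using norm_mult_less_1[OF ab] by (simp add: norm_mult norm_power mult.assoc)
  qed
  then have nz: "qpoch (a * b * c * d * ?q ^ m) ?q n \<noteq> 0" for m n
    by (rule qpoch_nonzero[OF q])
  have \<kappa>: "\<kappa> n \<noteq> 0" "\<kappa> n * coeff (p n) n = 2 ^ n" for n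
    using nz[of "n - 1" n] qpoch_nonzero[OF q ab(1), of n] qpoch_nonzero[OF q ab(2), of n]
    by (simp_all add: \<kappa>_def p(3))
  have D_coeff: "coeff (D n) n = 2 ^ n" for n
    by (simp add: D_def \<kappa>)
  have D_degree: "degree (D n) = n" for n
  proof (rule antisym)
    show "degree (D n) \<le> n"
      using p(2)[of n] degree_smult_le[of "\<kappa> n" "p n"] by (simp add: D_def)
    show "n \<le> degree (D n)"
      by (rule le_degree) (simp add: D_coeff)
  qed
  have orth: "aw_integral ?q a b c d (D m * D n) = 0" if "m < n" for m n
  proof -
    have "circle_int (\<lambda>z. aw_circ ?q a b c d z * poly (D m * D n) ((z + 1 / z) / 2)) =
        circle_int (\<lambda>z. \<kappa> n * (aw_circ ?q a b c d z * aw_sum ?q a b c d z n * poly (D m) ((z + 1 / z) / 2)))"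
    proof (rule circle_int_cong)
      fix z :: complex assume "norm z = 1"
      then have "z \<noteq> 0"
        by auto
      show "aw_circ ?q a b c d z * poly (D m * D n) ((z + 1 / z) / 2) =
          \<kappa> n * (aw_circ ?q a b c d z * aw_sum ?q a b c d z n * poly (D m) ((z + 1 / z) / 2))"
        unfolding poly_mult D_def[of n] poly_smult p(1)[OF \<open>z \<noteq> 0\<close>] by (simp only: mult_ac)
    qed
    also have "\<dots> = 0"
      unfolding circle_int_cmult using that
      by (subst circle_int_aw_sum[OF small]) (auto simp: coeff_eq_0 D_degree)
    finally show ?thesis
      unfolding aw_integral_eq_circle_int[OF small] by simp
  qed
  have sys: "is_aw_system a b c d ?q D"
    unfolding is_aw_system_iff[OF small]
  proof (intro conjI allI impI)
    fix m n :: nat assume "m \<noteq> n"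
    then show "aw_integral ?q a b c d (D m * D n) = 0"
      using orth[of m n] orth[of n m] unfolding mult.commute[of "D n" "D m"] by linarith
  qed (simp_all add: D_degree D_coeff)
  have uniq: "D' = D" if sys': "is_aw_system a b c d ?q D'" for D'
  proof
    fix n
    have "degree (D' n) = n \<and> lead_coeff (D' n) = 2 ^ n"
      using sys' unfolding is_aw_system_def by blast
    then have D': "degree (D' n) = n" "coeff (D' n) n = 2 ^ n"
      by auto
    \<comment> \<open>The leading terms cancel, so \<open>E\<close> and its conjugate have degree
      below \<open>n\<close>; both \<open>D' n\<close> and \<open>D n\<close> are orthogonal to the
      conjugate of \<open>E\<close>, hence so is \<open>E\<close>.\<close>
    define E where "E = D' n - D n"
    have E: "coeff E i = 0" if "i \<ge> n" for i
      using that D' D_degree[of n] D_coeff[of n] by (cases "i = n") (auto simp: E_def coeff_eq_0)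
    then have E': "coeff (map_poly cnj E) i = 0" if "i \<ge> n" for i
      using that by (simp add: coeff_map_poly)
    have "E * G = D' n * G + smult (-1) (D n * G)" for G
      by (simp add: E_def left_diff_distrib)
    then have "aw_integral ?q a b c d (E * map_poly cnj E) = 0"
      using aw_system_orthogonal[OF small sys' E'] aw_system_orthogonal[OF small sys E']
      by (simp only: aw_integral_add[OF small] aw_integral_smult[OF small]) simp
    then have "E = 0"
      using aw_integral_definite[OF assms(1-5) cnj] by blast
    then show "D' n = D n"
      by (simp add: E_def)
  qed
  have "aw_poly n a b c d ?q = D n"
    unfolding aw_poly_def by (simp only: the_equality[where P = "is_aw_system a b c d ?q", OF sys uniq])
  moreover have "x = (z + 1 / z) / 2"
    using z(2) by (simp add: mult.commute)
  then have "poly (p n) x = aw_sum ?q a b c d z n"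
    by (simp only: p(1)[OF z(1)])
  ultimately show ?thesis
    by (simp add: D_def \<kappa>_def)
qed

text \<open>Solves \<open>z * z - 2 * x * z + 1 = 0\<close>, whose roots are nonzero as their
  product is 1.\<close>

lemma joukowski_surj: "\<exists>z. z \<noteq> 0 \<and> 2 * x = z + 1 / (z :: complex)"
proof -
  define z where "z = x + csqrt (x\<^sup>2 - 1)"
  have "(z - x)\<^sup>2 = x\<^sup>2 - 1"
    by (simp add: z_def)
  then have *: "z * z + 1 = 2 * x * z"
    by (simp add: power2_eq_square algebra_simps)
  then have "z \<noteq> 0"
    by auto
  moreover have "2 * x = z + 1 / z"
    using * \<open>z \<noteq> 0\<close> by (simp add: field_simps)
  ultimately show ?thesis
    by blast
qed

section \<open>Rescaling\<close>

lemma asc_Q_rescale: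
  assumes s: "s\<^sup>2 = 1 - q" and ab: "a * b = \<rho>\<^sup>2" "a + b = s * \<rho> * y"
  shows "asc_Q n (x * s / 2) a b q = s ^ n * asc_P n x y \<rho> q"
proof (induction n rule: induct_nat_012)
  case (ge2 n)
  have q: "1 - q ^ Suc n = s * s * qnum q (Suc n)"
    unfolding qnum_eq[symmetric] by (simp add: s[symmetric] power2_eq_square)
  show ?case
    unfolding asc_Q.simps asc_P.simps ge2 ab q by (simp add: algebra_simps)
qed (simp_all add: ab algebra_simps)

text \<open>The linear coefficient \<open>(a + b) - 2 * x * (a * b) * q ^ n\<close> becomes
  \<open>s * \<rho> * (y - \<rho> * x * q ^ n)\<close> after rescaling. This is why \<open>x\<close>
  and \<open>y\<close> exchange roles and why powers of \<open>\<rho>\<close> appear in part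
  (iii).\<close>

lemma asc_dual_rescale:
  assumes s: "s\<^sup>2 = 1 - q" and ab: "a * b = \<rho>\<^sup>2" "a + b = s * \<rho> * y"
  shows "asc_dual n (x * s / 2) a b q = s ^ n * \<rho> ^ n * asc_P n y x \<rho> q"
proof (induction n rule: induct_nat_012)
  case (ge2 n)
  have q: "1 - q ^ Suc n = s * s * qnum q (Suc n)"
    unfolding qnum_eq[symmetric] by (simp add: s[symmetric] power2_eq_square)
  show ?case
    unfolding asc_dual.simps asc_P.simps ge2 ab q by (simp add: algebra_simps power2_eq_square)
qed (simp_all add: ab algebra_simps power2_eq_square)

lemma small_b_rescale:
  assumes s: "s\<^sup>2 = 1 - q"
  shows "small_b n (x * s / 2) q = s ^ n * big_B n x q"
proof (induction n rule: induct_nat_012)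
  case (ge2 n)
  have q: "1 - q ^ Suc n = s * s * qnum q (Suc n)"
    unfolding qnum_eq[symmetric] by (simp add: s[symmetric] power2_eq_square)
  show ?case
    unfolding small_b.simps big_B.simps ge2 q by (simp add: algebra_simps)
qed (simp_all add: algebra_simps)

text \<open>The bound on \<open>y\<close> makes the radicand nonnegative, so \<open>a\<close> and
  \<open>b\<close> are conjugate, and \<open>a * b = \<rho>\<^sup>2\<close> gives both the modulus
  \<open>\<bar>\<rho>\<bar>\<close>.\<close>

lemma aw_par:
  fixes q \<rho> y :: real
  assumes "q < 1" "\<bar>\<rho>\<bar> < 1" "y \<in> {- 2 / sqrt (1 - q) .. 2 / sqrt (1 - q)}"
  defines "a \<equiv> aw_par_minus \<rho> y q" and "b \<equiv> aw_par_plus \<rho> y q"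
  shows "a * b = (complex_of_real \<rho>)\<^sup>2" "a + b = complex_of_real (sqrt (1 - q)) * \<rho> * y"
    "cnj a = b" "cnj b = a" "norm a < 1" "norm b < 1"
proof -
  define s where "s = sqrt (1 - q)"
  have s: "s\<^sup>2 = 1 - q" "s > 0"
    using assms(1) by (simp_all add: s_def)
  have "\<bar>y\<bar> \<le> 2 / s"
    using assms(3) by (auto simp: s_def)
  then have "y\<^sup>2 \<le> (2 / s)\<^sup>2"
    using s(2) by (intro power2_le_iff_abs_le[THEN iffD2]) auto
  then have y: "4 / (1 - q) - y\<^sup>2 \<ge> 0"
    by (simp add: power_divide s)
  define r where "r = sqrt (4 / (1 - q) - y\<^sup>2)"
  have r: "r\<^sup>2 = 4 / (1 - q) - y\<^sup>2"
    using y by (simp add: r_def)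
  show cnj: "cnj a = b" "cnj b = a"
    by (simp_all add: a_def b_def aw_par_minus_def aw_par_plus_def)
  show "a + b = complex_of_real (sqrt (1 - q)) * \<rho> * y"
    by (simp add: a_def b_def aw_par_minus_def aw_par_plus_def algebra_simps)
  have "a * b = complex_of_real ((s / 2 * \<rho>)\<^sup>2 * (y\<^sup>2 + r\<^sup>2))"
    unfolding a_def b_def aw_par_minus_def aw_par_plus_def s_def[symmetric] r_def[symmetric]
    by (simp add: complex_eq_iff power2_eq_square algebra_simps)
  also have "(s / 2 * \<rho>)\<^sup>2 * (y\<^sup>2 + r\<^sup>2) = \<rho>\<^sup>2"
    using assms(1) by (simp add: r power_mult_distrib power_divide s)
  finally show ab: "a * b = (complex_of_real \<rho>)\<^sup>2"
    by simp
  have "norm a = norm b"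
    using complex_mod_cnj[of a] cnj by simp
  then have "(norm a)\<^sup>2 = \<bar>\<rho>\<bar>\<^sup>2"
    using arg_cong[OF ab, of norm] by (simp add: norm_mult norm_power power2_eq_square)
  then have "norm a = \<bar>\<rho>\<bar>"
    by (rule power2_eq_imp_eq) simp_all
  then show "norm a < 1"
    using assms(2) by simp
  then show "norm b < 1"
    using \<open>norm a = norm b\<close> by simp
qed

lemma powr_neg_half: "r > 0 \<Longrightarrow> r powr (- real n / 2) = 1 / sqrt r ^ n"
proof -
  assume "r > 0"
  have "r powr (- real n / 2) = 1 / r powr (1 / 2 * real n)"
    by (simp add: powr_minus_divide flip: powr_minus)
  also have "r powr (1 / 2 * real n) = sqrt r ^ n"
    using \<open>r > 0\<close> by (simp only: powr_powr[symmetric] powr_half_sqrt powr_realpow real_sqrt_gt_zero less_imp_le)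
  finally show ?thesis .
qed

lemma aw_A_rescale:
  fixes q \<rho>\<^sub>1 \<rho>\<^sub>2 y z :: real and x :: complex and n :: nat
  assumes "-1 < q" "q < 1" "\<bar>\<rho>\<^sub>1\<bar> < 1" "\<bar>\<rho>\<^sub>2\<bar> < 1"
    and "y \<in> {- 2 / sqrt (1 - q) .. 2 / sqrt (1 - q)}" "z \<in> {- 2 / sqrt (1 - q) .. 2 / sqrt (1 - q)}"
  defines "\<kappa> \<equiv> qpoch (\<rho>\<^sub>1\<^sup>2) q n * qpoch (\<rho>\<^sub>2\<^sup>2) q n / qpoch (\<rho>\<^sub>1\<^sup>2 * \<rho>\<^sub>2\<^sup>2 * q ^ (n - 1)) q n"
  shows "aw_A n x y \<rho>\<^sub>1 z \<rho>\<^sub>2 q = \<kappa>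
             * (\<Sum>j=0..n. qbinom q n j * big_B (n - j) x q
                 * (\<Sum>i=0..j. qbinom q j i * (asc_P i x y \<rho>\<^sub>1 q * asc_P (j - i) x z \<rho>\<^sub>2 q)
                      / (qpoch (\<rho>\<^sub>1\<^sup>2) q i * qpoch (\<rho>\<^sub>2\<^sup>2) q (j - i))))" (is ?A)
    and "aw_A n x y \<rho>\<^sub>1 z \<rho>\<^sub>2 q = \<kappa>
             * (\<Sum>m=0..n. (-1) ^ m * complex_of_real q ^ (m choose 2) * qbinom q n m
                 * complex_of_real \<rho>\<^sub>1 ^ m
                 * (asc_P (n - m) x z \<rho>\<^sub>2 q * asc_P m y x \<rho>\<^sub>1 q)
                 / (qpoch (\<rho>\<^sub>2\<^sup>2) q (n - m) * qpoch (\<rho>\<^sub>1\<^sup>2) q m))" (is ?B)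
proof -
  define a where "a = aw_par_minus \<rho>\<^sub>1 y q"
  define b where "b = aw_par_plus \<rho>\<^sub>1 y q"
  define c where "c = aw_par_minus \<rho>\<^sub>2 z q"
  define d where "d = aw_par_plus \<rho>\<^sub>2 z q"
  note par1 = aw_par[OF assms(2,3,5), folded a_def b_def]
  note par2 = aw_par[OF assms(2,4,6), folded c_def d_def]
  define s where "s = complex_of_real (sqrt (1 - q))"
  have s: "s\<^sup>2 = 1 - complex_of_real q" "s \<noteq> 0"
    using assms(2) by (simp_all add: s_def flip: of_real_power)
  define X where "X = x * s / 2"
  obtain w where w: "w \<noteq> 0" "2 * X = w + 1 / w"
    using joukowski_surj by blast
  have q: "norm (complex_of_real q) < 1"
    using assms by simp
  have ab: "norm (a * b) < 1" "norm (c * d) < 1"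
    by (intro norm_mult_less_1 par1 par2)+
  have "complex_of_real ((1 - q) powr (- real n / 2)) = 1 / s ^ n"
    by (subst powr_neg_half) (use assms(2) in \<open>simp_all add: s_def\<close>)
  then have "aw_A n x y \<rho>\<^sub>1 z \<rho>\<^sub>2 q = 1 / s ^ n * poly (aw_poly n a b c d q) X"
    by (simp only: aw_A_def X_def a_def b_def c_def d_def s_def)
  also have "poly (aw_poly n a b c d q) X =
      qpoch (a * b) q n * qpoch (c * d) q n / qpoch (a * b * c * d * q ^ (n - 1)) q n * aw_sum q a b c d w n"
    using assms(1,2) par1 par2 by (intro aw_poly_sum w) (auto simp: add_mset_commute)
  also have "a * b * c * d * complex_of_real (q ^ (n - 1)) = (a * b) * (c * d) * complex_of_real (q ^ (n - 1))"
    by (simp only: mult.assoc)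
  finally have A: "aw_A n x y \<rho>\<^sub>1 z \<rho>\<^sub>2 q = \<kappa> * (aw_sum q a b c d w n / s ^ n)"
    by (simp add: par1 par2 \<kappa>_def)
  note Q1 = asc_Q_rescale[OF s(1) par1(1) par1(2)[folded s_def], of _ x, folded X_def]
  note Q2 = asc_Q_rescale[OF s(1) par2(1) par2(2)[folded s_def], of _ x, folded X_def]
  note T1 = asc_dual_rescale[OF s(1) par1(1) par1(2)[folded s_def], of _ x, folded X_def]
  note b1 = small_b_rescale[OF s(1), of _ x, folded X_def]
  \<comment> \<open>Each summand carries \<open>s\<close> to the total power \<open>n\<close>, which
    cancels the prefactor \<open>1 / s ^ n\<close> of \<open>aw_A\<close>.\<close>
  have pow: "s ^ n = s ^ (n - j) * (s ^ i * s ^ (j - i))" if "i \<le> j" "j \<le> n" for i j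
    using that by (simp flip: power_add)
  have pow': "s ^ n = s ^ m * s ^ (n - m)" if "m \<le> n" for m
    using that by (simp flip: power_add)
  show ?A
    unfolding A aw_sum_eq_b_Q_Q[OF q ab w, symmetric] sum_divide_distrib sum_distrib_left Q1 Q2 b1 par1(1) par2(1)
  proof (intro sum.cong refl, goal_cases)
    case (1 j i)
    then have "i \<le> j" "j \<le> n"
      by auto
    then show ?case
      unfolding pow[OF \<open>i \<le> j\<close> \<open>j \<le> n\<close>] using s(2) by (simp add: mult_ac)
  qed
  show ?B
    unfolding A aw_sum_eq_Q_dual[OF q ab w, symmetric] sum_divide_distrib sum_distrib_left Q2 T1 par1(1) par2(1)
    using s(2) by (intro sum.cong refl) (simp add: pow' mult_ac)
qed

theorem theorem1:
  fixes q :: real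
  assumes "-1 < q" and "q < 1"
  shows
    "(\<forall>a b c d :: complex.
        norm a < 1 \<and> norm b < 1 \<and> norm c < 1 \<and> norm d < 1 \<and>
        image_mset cnj {#a, b, c, d#} = {#a, b, c, d#} \<longrightarrow>
        (\<forall>n\<ge>1. \<forall>x :: complex.
           poly (aw_poly n a b c d (complex_of_real q)) x =
             qpoch (a * b) q n * qpoch (c * d) q n / qpoch (a * b * c * d * q ^ (n - 1)) q n
             * (\<Sum>j=0..n. qbinom q n j * small_b (n - j) x q
                 * (\<Sum>i=0..j. qbinom q j i * (asc_Q i x a b q * asc_Q (j - i) x c d q)
                      / (qpoch (a * b) q i * qpoch (c * d) q (j - i))))))
     \<and>
     (\<forall>\<rho>\<^sub>1 \<rho>\<^sub>2 y z :: real.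
        \<bar>\<rho>\<^sub>1\<bar> < 1 \<and> \<bar>\<rho>\<^sub>2\<bar> < 1 \<and>
        y \<in> {- 2 / sqrt (1 - q) .. 2 / sqrt (1 - q)} \<and>
        z \<in> {- 2 / sqrt (1 - q) .. 2 / sqrt (1 - q)} \<longrightarrow>
        (\<forall>n\<ge>1. \<forall>x :: complex.
           aw_A n x y \<rho>\<^sub>1 z \<rho>\<^sub>2 q =
             qpoch (\<rho>\<^sub>1\<^sup>2) q n * qpoch (\<rho>\<^sub>2\<^sup>2) q n / qpoch (\<rho>\<^sub>1\<^sup>2 * \<rho>\<^sub>2\<^sup>2 * q ^ (n - 1)) q n
             * (\<Sum>j=0..n. qbinom q n j * big_B (n - j) x q
                 * (\<Sum>i=0..j. qbinom q j i * (asc_P i x y \<rho>\<^sub>1 q * asc_P (j - i) x z \<rho>\<^sub>2 q)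
                      / (qpoch (\<rho>\<^sub>1\<^sup>2) q i * qpoch (\<rho>\<^sub>2\<^sup>2) q (j - i)))))
        \<and>
        (\<forall>n\<ge>1. \<forall>x :: complex.
           aw_A n x y \<rho>\<^sub>1 z \<rho>\<^sub>2 q =
             qpoch (\<rho>\<^sub>1\<^sup>2) q n * qpoch (\<rho>\<^sub>2\<^sup>2) q n / qpoch (\<rho>\<^sub>1\<^sup>2 * \<rho>\<^sub>2\<^sup>2 * q ^ (n - 1)) q n
             * (\<Sum>m=0..n. (-1) ^ m * complex_of_real q ^ (m choose 2) * qbinom q n m
                 * complex_of_real \<rho>\<^sub>1 ^ m
                 * (asc_P (n - m) x z \<rho>\<^sub>2 q * asc_P m y x \<rho>\<^sub>1 q)
                 / (qpoch (\<rho>\<^sub>2\<^sup>2) q (n - m) * qpoch (\<rho>\<^sub>1\<^sup>2) q m))))"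
proof (intro conjI allI impI, goal_cases)
  case (1 a b c d n x)
  obtain z where z: "z \<noteq> 0" "2 * x = z + 1 / z"
    using joukowski_surj by blast
  have q: "norm (complex_of_real q) < 1"
    using assms by simp
  have ab: "norm (a * b) < 1" "norm (c * d) < 1"
    using 1 by (simp_all add: norm_mult_less_1)
  show ?case
    using 1 assms by (simp only: aw_sum_eq_b_Q_Q[OF q ab z]) (intro aw_poly_sum z, auto)
next
  case (2 \<rho>\<^sub>1 \<rho>\<^sub>2 y z n x)
  then show ?case
    using aw_A_rescale(1)[OF assms, of \<rho>\<^sub>1 \<rho>\<^sub>2 y z n x] by blast
next
  case (3 \<rho>\<^sub>1 \<rho>\<^sub>2 y z n x)
  then show ?case
    using aw_A_rescale(2)[OF assms, of \<rho>\<^sub>1 \<rho>\<^sub>2 y z n x] by blast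
qed

end
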